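(* Let $F=|y|\,\zeta\big(|x|,\frac{\langle x,y\rangle}{|y|}\big)$ be a spherically symmetric Finsler metric on a convex domain $\Omega\subseteq\mathbb{R}^n$. Then $F$ is locally projectively flat with zero flag curvature if and only if (i) $F=|y|$; or (ii) $$F=\frac{|y|^4}{z\,(\langle x,y\rangle\pm z)^2},$$ where $z=\sqrt{(1-c^2|x|^2)|y|^2+c^2\langle x,y\rangle^2}$ and $c$ is a nonzero constant.
   Context: $|\cdot|$ and $\langle\cdot,\cdot\rangle$ are the Euclidean norm and inner product on $\mathbb{R}^n$. A Finsler metric $F$ on a convex domain $\Omega\subseteq\mathbb{R}^n$ is spherically symmetric if $F(Sx,Sy)=F(x,y)$ for all $S\in O(n)$; such an $F$ can be expressed as $|y|\zeta(|x|,\langle x,y\rangle/|y|)$ with $\zeta$ a $C^\infty$ function. Summation over repeated indices is understood; subscripts $x^k,y^k$ denote partial derivatives. A Finsler metric on $\Omega$ is a nonnegative function $F$ on $\Omega\times\mathbb{R}^n$, $C^\infty$ on $\Omega\times(\mathbb{R}^n\setminus\{0\})$, such that for each $x$: $F(x,y)=0$ iff $y=0$, $F(x,\lambda y)=\lambda F(x,y)$ for $\lambda>0$, and $g_{ij}=[\frac12F^2]_{y^iy^j}$ is positive definite for $y\ne0$. With $(g^{ij})=(g_{ij})^{-1}$, the geodesic coefficients are $G^i=\frac14 g^{il}\{[F^2]_{x^my^l}y^m-[F^2]_{x^l}\}$. $F$ is (locally) projectively flat if all its geodesics are straight lines, equivalently $G^i=P\,y^i$ with $P=F_{x^k}y^k/(2F)$.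 For a tangent plane $\Pi=\mathrm{span}\{y,u\}$ the flag curvature is ${\bf K}(\Pi,y)=\dfrac{g_{im}R^i_{\ k}u^ku^m}{F^2g_{ij}u^iu^j-[g_{ij}y^iu^j]^2}$, where $R^i_{\ k}=2\frac{\partial G^i}{\partial x^k}-y^j\frac{\partial^2G^i}{\partial x^j\partial y^k}+2G^j\frac{\partial^2G^i}{\partial y^j\partial y^k}-\frac{\partial G^i}{\partial y^j}\frac{\partial G^j}{\partial y^k}$; for projectively flat $F$ one has ${\bf K}=(P^2-P_{x^m}y^m)/F^2$. Zero flag curvature means ${\bf K}=0$.
   Formalization: As printed the claim is false (F=2|y|; (ii) is flat only if c²=1). The formal version allows a constant factor a>0 in (i) and (ii), replaces ⟨x,y⟩±z by c⟨x,y⟩±z in (ii), and takes n≥2, since flags need a plane. *)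

theory Defs
  imports "HOL-Analysis.Analysis"
begin

text \<open>\<open>C\<^sup>k\<close> and \<open>C\<^sup>\<infinity>\<close> on an open set, via iterated directional derivatives.\<close>

fun Ck_on :: "nat \<Rightarrow> 'a set \<Rightarrow> ('a::real_normed_vector \<Rightarrow> 'b::real_normed_vector) \<Rightarrow> bool" where
  "Ck_on 0 S f \<longleftrightarrow> continuous_on S f"
| "Ck_on (Suc k) S f \<longleftrightarrow> (\<forall>x\<in>S. f differentiable (at x)) \<and>
     (\<forall>v. Ck_on k S (\<lambda>x. frechet_derivative f (at x) v))"

definition smooth_on :: "'a set \<Rightarrow> ('a::real_normed_vector \<Rightarrow> 'b::real_normed_vector) \<Rightarrow> bool" where
  "smooth_on S f \<longleftrightarrow> open S \<and> (\<forall>k. Ck_on k S f)"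

definition convex_domain :: "(real ^ 'n) set \<Rightarrow> bool" where
  "convex_domain \<Omega> \<longleftrightarrow> open \<Omega> \<and> \<Omega> \<noteq> {} \<and> convex \<Omega>"

text \<open>\<open>dx k H\<close> and \<open>dy k H\<close> are the partial derivatives of \<open>H x y\<close> in \<open>x\<^sup>k\<close> and in \<open>y\<^sup>k\<close>.\<close>

definition dx :: "'n \<Rightarrow> (real ^ 'n \<Rightarrow> real ^ 'n \<Rightarrow> real) \<Rightarrow> real ^ 'n \<Rightarrow> real ^ 'n \<Rightarrow> real" where
  "dx k H x y = frechet_derivative (\<lambda>x'. H x' y) (at x) (axis k 1)"

definition dy :: "'n \<Rightarrow> (real ^ 'n \<Rightarrow> real ^ 'n \<Rightarrow> real) \<Rightarrow> real ^ 'n \<Rightarrow> real ^ 'n \<Rightarrow> real" where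
  "dy k H x y = frechet_derivative (\<lambda>y'. H x y') (at y) (axis k 1)"

definition fund_tensor :: "(real ^ 'n \<Rightarrow> real ^ 'n \<Rightarrow> real) \<Rightarrow> real ^ 'n \<Rightarrow> real ^ 'n \<Rightarrow> real ^ 'n ^ 'n" where
  "fund_tensor F x y = (\<chi> i j. dy j (dy i (\<lambda>x y. (F x y)\<^sup>2 / 2)) x y)"

definition finsler_metric :: "(real ^ 'n) set \<Rightarrow> (real ^ 'n \<Rightarrow> real ^ 'n \<Rightarrow> real) \<Rightarrow> bool" where
  "finsler_metric \<Omega> F \<longleftrightarrow>
     (\<forall>x\<in>\<Omega>. \<forall>y. F x y \<ge> 0) \<and>
     smooth_on (\<Omega> \<times> (UNIV - {0})) (\<lambda>(x, y). F x y) \<and>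
     (\<forall>x\<in>\<Omega>. \<forall>y. F x y = 0 \<longleftrightarrow> y = 0) \<and>
     (\<forall>x\<in>\<Omega>. \<forall>y. \<forall>r>0. F x (r *\<^sub>R y) = r * F x y) \<and>
     (\<forall>x\<in>\<Omega>. \<forall>y. y \<noteq> 0 \<longrightarrow>
        (\<forall>u. u \<noteq> 0 \<longrightarrow> (\<Sum>i\<in>UNIV. \<Sum>j\<in>UNIV. fund_tensor F x y $ i $ j * u $ i * u $ j) > 0))"

text \<open>The identity \<open>F (S x) (S y) = F x y\<close> presupposes that the domain is invariant under \<open>O(n)\<close>.\<close>

definition spherically_symmetric :: "(real ^ 'n) set \<Rightarrow> (real ^ 'n \<Rightarrow> real ^ 'n \<Rightarrow> real) \<Rightarrow> bool" where
  "spherically_symmetric \<Omega> F \<longleftrightarrow>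
     (\<forall>S :: real ^ 'n ^ 'n. orthogonal_matrix S \<longrightarrow>
        (\<forall>x\<in>\<Omega>. S *v x \<in> \<Omega> \<and> (\<forall>y. F (S *v x) (S *v y) = F x y)))"

text \<open>
  \<open>F = |y| \<zeta>(|x|, \<langle>x,y\<rangle>/|y|)\<close> with \<open>\<zeta>\<close> of class \<open>C\<^sup>\<infinity>\<close>.  The pairs \<open>(|x|, \<langle>x,y\<rangle>/|y|)\<close> fill a
  set that is not open (\<open>|x| \<ge> 0\<close> and Cauchy-Schwarz), so smoothness of \<open>\<zeta>\<close> there means
  smoothness on some open neighbourhood.
\<close>

definition has_radial_profile ::
  "(real ^ 'n) set \<Rightarrow> (real ^ 'n \<Rightarrow> real ^ 'n \<Rightarrow> real) \<Rightarrow> (real \<Rightarrow> real \<Rightarrow> real) \<Rightarrow> bool" where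
  "has_radial_profile \<Omega> F \<zeta> \<longleftrightarrow>
     (\<exists>U. smooth_on U (\<lambda>(r, s). \<zeta> r s) \<and>
          (\<forall>x\<in>\<Omega>. \<forall>y. y \<noteq> 0 \<longrightarrow> (norm x, (x \<bullet> y) / norm y) \<in> U)) \<and>
     (\<forall>x\<in>\<Omega>. \<forall>y. y \<noteq> 0 \<longrightarrow> F x y = norm y * \<zeta> (norm x) ((x \<bullet> y) / norm y))"

definition geod_coeff :: "(real ^ 'n \<Rightarrow> real ^ 'n \<Rightarrow> real) \<Rightarrow> 'n \<Rightarrow> real ^ 'n \<Rightarrow> real ^ 'n \<Rightarrow> real" where
  "geod_coeff F i x y =
     1/4 * (\<Sum>l\<in>UNIV. matrix_inv (fund_tensor F x y) $ i $ l *
              ((\<Sum>m\<in>UNIV. dy l (dx m (\<lambda>x y. (F x y)\<^sup>2)) x y * y $ m) - dx l (\<lambda>x y. (F x y)\<^sup>2) x y))"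

text \<open>
  Geodesics solve \<open>\<sigma>'' + 2 G(\<sigma>, \<sigma>') = 0\<close>.  Constant curves are excluded, since \<open>F\<close> is
  not differentiable at \<open>y = 0\<close>.
\<close>

definition finsler_geodesic ::
  "(real ^ 'n) set \<Rightarrow> (real ^ 'n \<Rightarrow> real ^ 'n \<Rightarrow> real) \<Rightarrow> real \<Rightarrow> real \<Rightarrow> (real \<Rightarrow> real ^ 'n) \<Rightarrow> bool" where
  "finsler_geodesic \<Omega> F a b \<sigma> \<longleftrightarrow>
     (\<exists>\<sigma>'. \<forall>t\<in>{a<..<b}.
        \<sigma> t \<in> \<Omega> \<and> \<sigma>' t \<noteq> 0 \<and>
        (\<sigma> has_vector_derivative \<sigma>' t) (at t) \<and>
        (\<sigma>' has_vector_derivative (\<chi> i. - 2 * geod_coeff F i (\<sigma> t) (\<sigma>' t))) (at t))"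

definition projectively_flat :: "(real ^ 'n) set \<Rightarrow> (real ^ 'n \<Rightarrow> real ^ 'n \<Rightarrow> real) \<Rightarrow> bool" where
  "projectively_flat \<Omega> F \<longleftrightarrow>
     (\<forall>a b \<sigma>. finsler_geodesic \<Omega> F a b \<sigma> \<longrightarrow> collinear (\<sigma> ` {a<..<b}))"

definition riemann_curv ::
  "(real ^ 'n \<Rightarrow> real ^ 'n \<Rightarrow> real) \<Rightarrow> 'n \<Rightarrow> 'n \<Rightarrow> real ^ 'n \<Rightarrow> real ^ 'n \<Rightarrow> real" where
  "riemann_curv F i k x y =
     2 * dx k (geod_coeff F i) x y
     - (\<Sum>j\<in>UNIV. y $ j * dy k (dx j (geod_coeff F i)) x y)
     + 2 * (\<Sum>j\<in>UNIV. geod_coeff F j x y * dy k (dy j (geod_coeff F i)) x y)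
     - (\<Sum>j\<in>UNIV. dy j (geod_coeff F i) x y * dy k (geod_coeff F j) x y)"

text \<open>\<open>flag_curv F x y u\<close> is the flag curvature at \<open>x\<close> of the flag with pole \<open>y\<close> and plane \<open>span {y, u}\<close>.\<close>

definition flag_curv ::
  "(real ^ 'n \<Rightarrow> real ^ 'n \<Rightarrow> real) \<Rightarrow> real ^ 'n \<Rightarrow> real ^ 'n \<Rightarrow> real ^ 'n \<Rightarrow> real" where
  "flag_curv F x y u =
     (\<Sum>i\<in>UNIV. \<Sum>m\<in>UNIV. \<Sum>k\<in>UNIV.
        fund_tensor F x y $ i $ m * riemann_curv F i k x y * u $ k * u $ m) /
     ((F x y)\<^sup>2 * (\<Sum>i\<in>UNIV. \<Sum>j\<in>UNIV. fund_tensor F x y $ i $ j * u $ i * u $ j)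
      - (\<Sum>i\<in>UNIV. \<Sum>j\<in>UNIV. fund_tensor F x y $ i $ j * y $ i * u $ j)\<^sup>2)"

definition zero_flag_curvature :: "(real ^ 'n) set \<Rightarrow> (real ^ 'n \<Rightarrow> real ^ 'n \<Rightarrow> real) \<Rightarrow> bool" where
  "zero_flag_curvature \<Omega> F \<longleftrightarrow>
     (\<forall>x\<in>\<Omega>. \<forall>y u. dim (span {y, u}) = 2 \<longrightarrow> flag_curv F x y u = 0)"

definition z_fun :: "real \<Rightarrow> real ^ 'n \<Rightarrow> real ^ 'n \<Rightarrow> real" where
  "z_fun c x y = sqrt ((1 - c\<^sup>2 * (norm x)\<^sup>2) * (norm y)\<^sup>2 + c\<^sup>2 * (x \<bullet> y)\<^sup>2)"

end

theory Submission
  imports Defs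
begin

text \<open>
  Put \<open>P = F\<^sub>x y / (2 F)\<close>.  Straightness of the geodesics is equivalent to \<open>G = P y\<close>, that is to
  \<open>F\<^sub>x = (P F)\<^sub>y\<close>; the curvature tensor then has the form \<open>\<Xi> id + y \<otimes> \<tau>\<close> with \<open>\<Xi> = P\<^sup>2 - P\<^sub>x y\<close>,
  and it is flat on all flags iff \<open>P\<^sub>x = P P\<^sub>y\<close>.  By symmetry \<open>F(0, y) = a |y|\<close> and
  \<open>P(0, y) = b |y|\<close>.  Along the characteristics \<open>t \<mapsto> (t x, y\<^sub>0 - t b |y\<^sub>0| x)\<close> the factor \<open>P\<close> is
  constant and \<open>F (|y\<^sub>0| - t b \<langle>y\<^sub>0, x\<rangle>)\<close> is conserved, so \<open>a\<close> and \<open>b\<close> determine \<open>F\<close>: solving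
  \<open>N = |y + b N x|\<close> for \<open>N = |y\<^sub>0|\<close> gives \<open>F = a N\<^sup>2 / z\<close>, the stated formula, with \<open>b = 0\<close> the
  Euclidean case.
\<close>

section \<open>Smooth functions and partial derivatives\<close>

text \<open>Flatness is stated through geodesics, so before it can be used a geodesic must be
  produced through every (x, y) with y nonzero; hence the smoothness of the spray coefficients and
  the local existence theorem below. The equation P_x = P P_y is of Burgers type: its
  characteristics are straight lines, explicit once P is known at the origin. The factor |y0| - t b
  <y0, x> has a meaning: it is |y0| times 1 - t b <y0, x> / |y0|, the amount by which the map y0 |->
  y0 - t b |y0| x stretches the direction x. Hamel's condition F_x = P F_y + P_y F is the matching
  continuity equation, so F times this stretching is conserved. The closed formula lives where b^2
  |x|^2 < 1, and no hypothesis confines the domain to that ball. In one direction of the equivalence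
  F would blow up on the boundary sphere; in the other z would vanish on vectors tangent to that
  sphere, against the positivity of F.\<close>

lemma frechet_derivative_cong_open:
  assumes "open S" "x \<in> S" "\<And>y. y \<in> S \<Longrightarrow> f y = g y"
  shows "frechet_derivative f (at x) = frechet_derivative g (at x)"
proof -
  have "(f has_derivative D) (at x) \<longleftrightarrow> (g has_derivative D) (at x)" for D
    using has_derivative_transform_within_open[OF _ assms(1,2)] assms(3) by metis
  then show ?thesis by (simp add: frechet_derivative_def)
qed

lemma differentiable_cong_open:
  assumes "open S" "x \<in> S" "\<And>y. y \<in> S \<Longrightarrow> f y = g y"
  shows "f differentiable (at x) \<longleftrightarrow> g differentiable (at x)"
  using assms has_derivative_transform_within_open[OF _ assms(1,2)]
  unfolding differentiable_def by metis

lemma Ck_on_cong: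
  assumes "open S" "\<And>x. x \<in> S \<Longrightarrow> f x = g x"
  shows "Ck_on k S f \<longleftrightarrow> Ck_on k S g"
  using assms
proof (induction k arbitrary: f g)
  case 0
  then show ?case by (auto cong: continuous_on_cong)
next
  case (Suc k)
  have "f differentiable (at x) \<longleftrightarrow> g differentiable (at x)" if "x \<in> S" for x
    using differentiable_cong_open[OF Suc.prems(1) that] Suc.prems(2) by blast
  moreover have "Ck_on k S (\<lambda>x. frechet_derivative f (at x) v)
      \<longleftrightarrow> Ck_on k S (\<lambda>x. frechet_derivative g (at x) v)" for v
    by (rule Suc.IH[OF Suc.prems(1)]) (metis Suc.prems frechet_derivative_cong_open)
  ultimately show ?case by auto
qed

text \<open>Replaces the choice hidden in \<open>frechet_derivative\<close> by an explicit
  derivative \<open>D\<close>; the closure properties of \<open>Ck_on\<close> that follow are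
  inductions through this rule.\<close>

lemma Ck_on_SucI:
  assumes "open S" "\<And>x. x \<in> S \<Longrightarrow> (f has_derivative D x) (at x)"
    "\<And>v. Ck_on k S (\<lambda>x. D x v)"
  shows "Ck_on (Suc k) S f"
proof -
  have "Ck_on k S (\<lambda>x. frechet_derivative f (at x) v)" for v
    using assms(3)[of v] Ck_on_cong[OF assms(1), of "\<lambda>x. D x v" "\<lambda>x. frechet_derivative f (at x) v" k]
      frechet_derivative_at[OF assms(2)] by metis
  then show ?thesis using assms(2) by (auto simp: differentiable_def)
qed

lemma Ck_on_SucD:
  assumes "Ck_on (Suc k) S f" "x \<in> S"
  shows "(f has_derivative frechet_derivative f (at x)) (at x)"
  using assms by (simp flip: frechet_derivative_works)

lemma Ck_on_Suc_imp: "Ck_on (Suc k) S f \<Longrightarrow> Ck_on k S f"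
proof (induction k arbitrary: f)
  case 0
  then have "f differentiable_on S" by (auto intro: differentiable_at_imp_differentiable_on)
  then show ?case by (simp add: differentiable_imp_continuous_on)
next
  case (Suc k)
  then show ?case by (metis Ck_on.simps(2))
qed

lemma Ck_on_const: "open S \<Longrightarrow> Ck_on k S (\<lambda>x. c)"
proof (induction k arbitrary: c)
  case (Suc k)
  show ?case by (rule Ck_on_SucI[where D="\<lambda>x v. 0"]) (use Suc in \<open>auto\<close>)
qed auto

lemma Ck_on_bounded_linear:
  assumes "open S" "bounded_linear f" shows "Ck_on k S f"
proof (cases k)
  case 0
  then show ?thesis by (simp add: assms linear_continuous_on)
next
  case (Suc k')
  show ?thesis unfolding Suc
    by (rule Ck_on_SucI[where D="\<lambda>x. f"])
      (use assms in \<open>auto intro: bounded_linear_imp_has_derivative Ck_on_const\<close>)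
qed

lemma Ck_on_add:
  assumes "open S" "Ck_on k S f" "Ck_on k S g"
  shows "Ck_on k S (\<lambda>x. f x + g x)"
  using assms(2,3)
proof (induction k arbitrary: f g)
  case 0
  then show ?case by (auto intro: continuous_intros)
next
  case (Suc k)
  note d = Ck_on_SucD[OF Suc.prems(1)] Ck_on_SucD[OF Suc.prems(2)]
  show ?case
    by (rule Ck_on_SucI[OF assms(1) has_derivative_add[OF d]]) (use Suc in auto)
qed

lemma Ck_on_mult:
  fixes f g :: "'a::real_normed_vector \<Rightarrow> real"
  assumes "open S" "Ck_on k S f" "Ck_on k S g"
  shows "Ck_on k S (\<lambda>x. f x * g x)"
  using assms(2,3)
proof (induction k arbitrary: f g)
  case 0
  then show ?case by (auto intro: continuous_intros)
next
  case (Suc k)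
  note d = Ck_on_SucD[OF Suc.prems(1)] Ck_on_SucD[OF Suc.prems(2)]
  show ?case
    by (rule Ck_on_SucI[OF assms(1) has_derivative_mult[OF d]])
      (use Suc in \<open>auto intro!: Ck_on_add[OF assms(1)] Suc.IH intro: Ck_on_Suc_imp\<close>)
qed

text \<open>The derivative of 1/f is a product of 1/f, f' and 1/f, so the induction hypothesis for
  1/f itself closes the step and no composition rule for higher derivatives is involved.\<close>

lemma Ck_on_inverse:
  fixes f :: "'a::real_normed_vector \<Rightarrow> real"
  assumes "open S" "\<And>x. x \<in> S \<Longrightarrow> f x \<noteq> 0" "Ck_on k S f"
  shows "Ck_on k S (\<lambda>x. inverse (f x))"
  using assms(3)
proof (induction k)
  case 0
  then show ?case using assms(2) by (auto intro: continuous_intros)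
next
  case (Suc k)
  have IH: "Ck_on k S (\<lambda>x. inverse (f x))"
    using Suc Ck_on_Suc_imp by blast
  have d: "((\<lambda>x. inverse (f x)) has_derivative
      (\<lambda>v. (-1) * (inverse (f x) * frechet_derivative f (at x) v * inverse (f x)))) (at x)"
    if "x \<in> S" for x
    using Deriv.has_derivative_inverse[OF assms(2)[OF that] Ck_on_SucD[OF Suc.prems that]] by simp
  show ?case
  proof (rule Ck_on_SucI[OF assms(1) d])
    show "Ck_on k S (\<lambda>x. (-1) * (inverse (f x) * frechet_derivative f (at x) v * inverse (f x)))" for v
      by (intro Ck_on_mult[OF assms(1)] IH Ck_on_const[OF assms(1)]) (use Suc.prems in auto)
  qed
qed

lemma smooth_on_open: "smooth_on S f \<Longrightarrow> open S"
  by (simp add: smooth_on_def)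

lemma smooth_on_cong: "(\<And>x. x \<in> S \<Longrightarrow> f x = g x) \<Longrightarrow> smooth_on S f \<longleftrightarrow> smooth_on S g"
  unfolding smooth_on_def using Ck_on_cong by metis

lemma smooth_on_const: "open S \<Longrightarrow> smooth_on S (\<lambda>x. c)"
  by (simp add: smooth_on_def Ck_on_const)

lemma smooth_on_bounded_linear: "open S \<Longrightarrow> bounded_linear f \<Longrightarrow> smooth_on S f"
  by (simp add: smooth_on_def Ck_on_bounded_linear)

lemma smooth_on_add: "smooth_on S f \<Longrightarrow> smooth_on S g \<Longrightarrow> smooth_on S (\<lambda>x. f x + g x)"
  by (simp add: smooth_on_def Ck_on_add)

lemma smooth_on_mult:
  fixes f g :: "'a::real_normed_vector \<Rightarrow> real"
  shows "smooth_on S f \<Longrightarrow> smooth_on S g \<Longrightarrow> smooth_on S (\<lambda>x. f x * g x)"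
  by (simp add: smooth_on_def Ck_on_mult)

lemma smooth_on_inverse:
  fixes f :: "'a::real_normed_vector \<Rightarrow> real"
  shows "smooth_on S f \<Longrightarrow> (\<And>x. x \<in> S \<Longrightarrow> f x \<noteq> 0) \<Longrightarrow> smooth_on S (\<lambda>x. inverse (f x))"
  by (simp add: smooth_on_def Ck_on_inverse)

lemma smooth_on_sum:
  assumes "open S" "\<And>i. i \<in> I \<Longrightarrow> smooth_on S (f i)"
  shows "smooth_on S (\<lambda>x. \<Sum>i\<in>I. f i x)"
  using assms(2) by (induction I rule: infinite_finite_induct)
    (auto intro: smooth_on_add smooth_on_const assms(1))

lemma smooth_on_prod:
  fixes f :: "'i \<Rightarrow> 'a::real_normed_vector \<Rightarrow> real"
  assumes "open S" "\<And>i. i \<in> I \<Longrightarrow> smooth_on S (f i)"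
  shows "smooth_on S (\<lambda>x. \<Prod>i\<in>I. f i x)"
  using assms(2) by (induction I rule: infinite_finite_induct)
    (auto intro: smooth_on_mult smooth_on_const assms(1))

lemma smooth_on_has_derivative:
  assumes "smooth_on S f" "x \<in> S"
  shows "(f has_derivative frechet_derivative f (at x)) (at x)"
proof -
  have "Ck_on (Suc 0) S f" using assms unfolding smooth_on_def by blast
  from Ck_on_SucD[OF this assms(2)] show ?thesis .
qed

lemma smooth_on_frechet_derivative:
  "smooth_on S f \<Longrightarrow> smooth_on S (\<lambda>x. frechet_derivative f (at x) v)"
  unfolding smooth_on_def using Ck_on.simps(2) by metis

lemma smooth_on_continuous: "smooth_on S f \<Longrightarrow> continuous_on S f"
  unfolding smooth_on_def using Ck_on.simps(1) by blast

lemma Ck_on_linear_compose: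
  assumes "open S" "bounded_linear h" "Ck_on k S f"
  shows "Ck_on k S (\<lambda>x. h (f x))"
  using assms(3)
proof (induction k arbitrary: f)
  case 0
  then show ?case using bounded_linear.continuous_on[OF assms(2)] by auto
next
  case (Suc k)
  show ?case
    by (rule Ck_on_SucI[OF assms(1) bounded_linear.has_derivative[OF assms(2) Ck_on_SucD[OF Suc.prems]]])
      (use Suc in auto)
qed

lemma smooth_on_linear_compose:
  "bounded_linear h \<Longrightarrow> smooth_on S f \<Longrightarrow> smooth_on S (\<lambda>x. h (f x))"
  by (simp add: smooth_on_def Ck_on_linear_compose)

text \<open>Smoothness is encoded by directional derivatives. This bounds the operator norm of the
  derivative by finitely many of them, hence by a continuous function.\<close>

lemma onorm_le_sum_Basis:
  fixes f :: "'a::euclidean_space \<Rightarrow> 'b::real_normed_vector"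
  assumes "bounded_linear f"
  shows "onorm f \<le> (\<Sum>b\<in>Basis. norm (f b))"
proof (rule onorm_le)
  fix x
  have l: "linear f" using assms by (rule bounded_linear.linear)
  have "f x = f (\<Sum>b\<in>Basis. (x \<bullet> b) *\<^sub>R b)" by (simp add: euclidean_representation)
  also have "\<dots> = (\<Sum>b\<in>Basis. (x \<bullet> b) *\<^sub>R f b)"
    by (simp add: linear_sum[OF l] linear_scale[OF l])
  finally have "norm (f x) \<le> (\<Sum>b\<in>Basis. norm ((x \<bullet> b) *\<^sub>R f b))"
    using norm_sum by metis
  also have "\<dots> \<le> (\<Sum>b\<in>Basis. norm (f b) * norm x)"
    by (intro sum_mono, subst mult.commute) (auto intro!: mult_right_mono Basis_le_norm)
  finally show "norm (f x) \<le> (\<Sum>b\<in>Basis. norm (f b)) * norm x" by (simp add: sum_distrib_right)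
qed

text \<open>Compactness of a closed ball bounds the derivative and convexity allows the mean value
  inequality. The result feeds the existence theorem for differential equations.\<close>

lemma smooth_on_locally_lipschitz:
  fixes f :: "'a::euclidean_space \<Rightarrow> 'b::real_normed_vector"
  assumes f: "smooth_on S f" and z: "z \<in> S"
  obtains e L where "e > 0" "cball z e \<subseteq> S"
    "\<And>u v. u \<in> cball z e \<Longrightarrow> v \<in> cball z e \<Longrightarrow> norm (f u - f v) \<le> L * norm (u - v)"
proof -
  obtain e where e: "e > 0" "cball z e \<subseteq> S"
    using smooth_on_open[OF f] z open_contains_cball by blast
  define g where "g = (\<lambda>x. \<Sum>b\<in>Basis. norm (frechet_derivative f (at x) b))"
  have "continuous_on S g" unfolding g_def
    by (intro continuous_intros smooth_on_continuous smooth_on_frechet_derivative f)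
  then have "continuous_on (cball z e) g" using e(2) continuous_on_subset by blast
  then have "bounded (g ` cball z e)"
    by (intro compact_imp_bounded compact_continuous_image) auto
  then obtain L where L: "\<And>x. x \<in> cball z e \<Longrightarrow> norm (g x) \<le> L"
    unfolding bounded_iff by blast
  show thesis
  proof (rule that[OF e])
    fix u v assume "u \<in> cball z e" "v \<in> cball z e"
    then show "norm (f u - f v) \<le> L * norm (u - v)"
    proof (rule differentiable_bound[rotated 3])
      fix x assume x: "x \<in> cball z e"
      then have d: "(f has_derivative frechet_derivative f (at x)) (at x)"
        using e smooth_on_has_derivative[OF f] by blast
      then show "(f has_derivative frechet_derivative f (at x)) (at x within cball z e)"
        by (rule has_derivative_at_withinI)
      have "onorm (frechet_derivative f (at x)) \<le> g x"
        unfolding g_def by (rule onorm_le_sum_Basis[OF has_derivative_bounded_linear[OF d]])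
      with L[OF x] show "onorm (frechet_derivative f (at x)) \<le> L" by simp
    qed simp
  qed
qed

section \<open>Smooth functions of pairs (x, y) with y nonzero, and their partial
  derivatives\<close>

definition smooth2 :: "(real ^ 'n) set \<Rightarrow> (real ^ 'n \<Rightarrow> real ^ 'n \<Rightarrow> real) \<Rightarrow> bool" where
  "smooth2 \<Omega> H \<longleftrightarrow> smooth_on (\<Omega> \<times> (UNIV - {0})) (\<lambda>(x, y). H x y)"

abbreviation grad_x :: "(real ^ 'n \<Rightarrow> real ^ 'n \<Rightarrow> real) \<Rightarrow> real ^ 'n \<Rightarrow> real ^ 'n \<Rightarrow> real ^ 'n \<Rightarrow> real" where
  "grad_x H x y v \<equiv> \<Sum>k\<in>UNIV. dx k H x y * v $ k"

abbreviation grad_y :: "(real ^ 'n \<Rightarrow> real ^ 'n \<Rightarrow> real) \<Rightarrow> real ^ 'n \<Rightarrow> real ^ 'n \<Rightarrow> real ^ 'n \<Rightarrow> real" where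
  "grad_y H x y v \<equiv> \<Sum>k\<in>UNIV. dy k H x y * v $ k"

lemma open_slit: "open \<Omega> \<Longrightarrow> open (\<Omega> \<times> (UNIV - {0::'a::real_normed_vector}))"
  by (simp add: open_Times open_Diff)

lemma linear_expand_axis:
  fixes L :: "real ^ 'n \<Rightarrow> real"
  assumes "linear L" shows "L v = (\<Sum>k\<in>UNIV. L (axis k 1) * v $ k)"
proof -
  have "L v = L (\<Sum>k\<in>UNIV. (v $ k) *\<^sub>R axis k 1)"
    by (simp add: basis_expansion[of v, unfolded scalar_mult_eq_scaleR])
  also have "\<dots> = (\<Sum>k\<in>UNIV. L (axis k 1) * v $ k)"
    by (simp add: linear_sum[OF assms] linear_scale[OF assms] mult.commute)
  finally show ?thesis .
qed

text \<open>Links two notions: \<open>dx\<close> and \<open>dy\<close> freeze the other argument,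
  while smoothness is about the total derivative of the uncurried function on the product.\<close>

lemma
  fixes H :: "real ^ 'n \<Rightarrow> real ^ 'n \<Rightarrow> real"
  assumes "smooth2 \<Omega> H" "x \<in> \<Omega>" "y \<noteq> 0"
  shows dx_eq_frechet: "dx k H x y = frechet_derivative (\<lambda>(x, y). H x y) (at (x, y)) (axis k 1, 0)"
    and dy_eq_frechet: "dy k H x y = frechet_derivative (\<lambda>(x, y). H x y) (at (x, y)) (0, axis k 1)"
    and smooth2_has_derivative:
      "((\<lambda>(x, y). H x y) has_derivative (\<lambda>(v, w). grad_x H x y v + grad_y H x y w)) (at (x, y))"
proof -
  let ?f = "\<lambda>(x, y). H x y"
  define D where "D = frechet_derivative ?f (at (x, y))"
  have D: "(?f has_derivative D) (at (x, y))"
    unfolding D_def by (rule smooth_on_has_derivative) (use assms in \<open>auto simp: smooth2_def\<close>)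
  have l: "linear D" using D has_derivative_linear by blast
  have "((\<lambda>x'. ?f (x', y)) has_derivative (\<lambda>v. D (v, 0))) (at x)"
    by (rule has_derivative_compose[where g="?f"]) (auto intro!: derivative_eq_intros D)
  from frechet_derivative_at[OF this]
  have 1: "frechet_derivative (\<lambda>x'. H x' y) (at x) = (\<lambda>v. D (v, 0))" by simp
  have "((\<lambda>y'. ?f (x, y')) has_derivative (\<lambda>v. D (0, v))) (at y)"
    by (rule has_derivative_compose[where g="?f"]) (auto intro!: derivative_eq_intros D)
  from frechet_derivative_at[OF this]
  have 2: "frechet_derivative (\<lambda>y'. H x y') (at y) = (\<lambda>v. D (0, v))" by simp
  show 3: "dx k H x y = D (axis k 1, 0)" for k unfolding dx_def 1 ..
  show 4: "dy k H x y = D (0, axis k 1)" for k unfolding dy_def 2 ..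
  have i: "linear (\<lambda>v. (v, 0::real ^ 'n))" "linear (\<lambda>w. (0::real ^ 'n, w))"
    by (simp_all add: linear_iff)
  have l1: "linear (\<lambda>v. D (v, 0))" using linear_compose[OF i(1) l] by (simp only: o_def)
  have l2: "linear (\<lambda>w. D (0, w))" using linear_compose[OF i(2) l] by (simp only: o_def)
  have "D (v, w) = grad_x H x y v + grad_y H x y w" for v w
  proof -
    have "D (v, w) = D (v, 0) + D (0, w)" using linear_add[OF l, of "(v, 0)" "(0, w)"] by simp
    then show ?thesis
      unfolding 3 4 linear_expand_axis[OF l1, of v] linear_expand_axis[OF l2, of w] .
  qed
  then have "D = (\<lambda>(v, w). grad_x H x y v + grad_y H x y w)" by auto
  then show "(?f has_derivative (\<lambda>(v, w). grad_x H x y v + grad_y H x y w)) (at (x, y))"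
    using D by simp
qed

text \<open>The chain rule behind lines, rays and characteristics. The filter is relative to a set
  so that the endpoints of the parameter interval [0, 1] of a characteristic are covered.\<close>

lemma smooth2_along_curve:
  fixes H :: "real ^ 'n \<Rightarrow> real ^ 'n \<Rightarrow> real"
  assumes "smooth2 \<Omega> H" "X t \<in> \<Omega>" "Y t \<noteq> 0"
    and "(X has_vector_derivative v) (at t within S)" "(Y has_vector_derivative w) (at t within S)"
  shows "((\<lambda>s. H (X s) (Y s)) has_real_derivative grad_x H (X t) (Y t) v + grad_y H (X t) (Y t) w)
    (at t within S)"
proof -
  let ?f = "\<lambda>(x, y). H x y"
  have "((\<lambda>s. (X s, Y s)) has_derivative (\<lambda>h. (h *\<^sub>R v, h *\<^sub>R w))) (at t within S)"
    using assms(4,5) by (intro has_derivative_Pair) (auto simp: has_vector_derivative_def)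
  from has_derivative_compose[OF this smooth2_has_derivative[OF assms(1-3)]]
  have "((\<lambda>s. H (X s) (Y s)) has_derivative
      (\<lambda>h. grad_x H (X t) (Y t) (h *\<^sub>R v) + grad_y H (X t) (Y t) (h *\<^sub>R w))) (at t within S)"
    by simp
  then show ?thesis
    unfolding has_field_derivative_def
    by (rule has_derivative_eq_rhs) (auto simp: sum_distrib_left algebra_simps fun_eq_iff)
qed

lemma grad_axis [simp]: "(\<Sum>k\<in>UNIV. f k * axis i (1::real) $ k) = f i"
  by (simp add: axis_def if_distrib cong: if_cong)

lemma smooth2_dx_line:
  assumes "smooth2 \<Omega> H" "x \<in> \<Omega>" "y \<noteq> 0"
  shows "((\<lambda>t. H (x + t *\<^sub>R axis k 1) y) has_real_derivative dx k H x y) (at 0)"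
proof -
  have "((\<lambda>t. x + t *\<^sub>R axis k 1) has_vector_derivative axis k 1) (at 0)"
    by (auto intro!: derivative_eq_intros)
  from smooth2_along_curve[OF assms(1) _ _ this, of "\<lambda>_. y" 0] assms show ?thesis
    by simp
qed

lemma smooth2_dy_line:
  assumes "smooth2 \<Omega> H" "x \<in> \<Omega>" "y \<noteq> 0"
  shows "((\<lambda>t. H x (y + t *\<^sub>R axis k 1)) has_real_derivative dy k H x y) (at 0)"
proof -
  have "((\<lambda>t. y + t *\<^sub>R axis k 1) has_vector_derivative axis k 1) (at 0)"
    by (auto intro!: derivative_eq_intros)
  from smooth2_along_curve[OF assms(1) _ _ _ this, of "\<lambda>_. x" 0] assms show ?thesis
    by simp
qed

lemma smooth2_dx: assumes "smooth2 \<Omega> H" shows "smooth2 \<Omega> (dx k H)"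
proof -
  let ?S = "\<Omega> \<times> (UNIV - {0})"
  have "smooth_on ?S (\<lambda>(x, y). dx k H x y)
      \<longleftrightarrow> smooth_on ?S (\<lambda>w. frechet_derivative (\<lambda>(x, y). H x y) (at w) (axis k 1, 0))"
    by (rule smooth_on_cong) (use dx_eq_frechet[OF assms] in auto)
  then show ?thesis
    by (simp only: smooth2_def smooth_on_frechet_derivative[OF assms[unfolded smooth2_def]])
qed

lemma smooth2_dy: assumes "smooth2 \<Omega> H" shows "smooth2 \<Omega> (dy k H)"
proof -
  let ?S = "\<Omega> \<times> (UNIV - {0})"
  have "smooth_on ?S (\<lambda>(x, y). dy k H x y)
      \<longleftrightarrow> smooth_on ?S (\<lambda>w. frechet_derivative (\<lambda>(x, y). H x y) (at w) (0, axis k 1))"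
    by (rule smooth_on_cong) (use dy_eq_frechet[OF assms] in auto)
  then show ?thesis
    by (simp only: smooth2_def smooth_on_frechet_derivative[OF assms[unfolded smooth2_def]])
qed

lemma smooth2_cong:
  "(\<And>x y. x \<in> \<Omega> \<Longrightarrow> y \<noteq> 0 \<Longrightarrow> H x y = K x y) \<Longrightarrow> smooth2 \<Omega> H \<longleftrightarrow> smooth2 \<Omega> K"
  unfolding smooth2_def by (rule smooth_on_cong) auto

lemma smooth2_const: "open \<Omega> \<Longrightarrow> smooth2 \<Omega> (\<lambda>x y. c)"
  unfolding smooth2_def by (simp add: split_def smooth_on_const open_slit)

lemma smooth2_coord: "open \<Omega> \<Longrightarrow> smooth2 \<Omega> (\<lambda>x y. y $ k)"
  unfolding smooth2_def split_def
  by (rule smooth_on_bounded_linear)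
    (auto intro: open_slit bounded_linear_compose[OF bounded_linear_vec_nth bounded_linear_snd])

lemma smooth2_add: "smooth2 \<Omega> H \<Longrightarrow> smooth2 \<Omega> K \<Longrightarrow> smooth2 \<Omega> (\<lambda>x y. H x y + K x y)"
  unfolding smooth2_def split_def by (rule smooth_on_add)

lemma smooth2_mult: "smooth2 \<Omega> H \<Longrightarrow> smooth2 \<Omega> K \<Longrightarrow> smooth2 \<Omega> (\<lambda>x y. H x y * K x y)"
  unfolding smooth2_def split_def by (rule smooth_on_mult)

lemma smooth2_cmult: "smooth2 \<Omega> H \<Longrightarrow> smooth2 \<Omega> (\<lambda>x y. c * H x y)"
  unfolding smooth2_def split_def
  by (rule smooth_on_mult[OF smooth_on_const[OF smooth_on_open]])

lemma smooth2_diff: "smooth2 \<Omega> H \<Longrightarrow> smooth2 \<Omega> K \<Longrightarrow> smooth2 \<Omega> (\<lambda>x y. H x y - K x y)"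
  using smooth2_add[OF _ smooth2_cmult[where c="-1"], of \<Omega> H K] by simp

lemma smooth2_power2: "smooth2 \<Omega> H \<Longrightarrow> smooth2 \<Omega> (\<lambda>x y. (H x y)\<^sup>2)"
  unfolding power2_eq_square by (rule smooth2_mult)

lemma smooth2_divide:
  assumes "smooth2 \<Omega> H" "smooth2 \<Omega> K" "\<And>x y. x \<in> \<Omega> \<Longrightarrow> y \<noteq> 0 \<Longrightarrow> K x y \<noteq> 0"
  shows "smooth2 \<Omega> (\<lambda>x y. H x y / K x y)"
  using assms unfolding smooth2_def split_def divide_inverse
  by (intro smooth_on_mult smooth_on_inverse) auto

lemma smooth2_sum:
  "open \<Omega> \<Longrightarrow> (\<And>i. i \<in> I \<Longrightarrow> smooth2 \<Omega> (H i)) \<Longrightarrow> smooth2 \<Omega> (\<lambda>x y. \<Sum>i\<in>I. H i x y)"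
  unfolding smooth2_def split_def by (intro smooth_on_sum open_slit)

lemma smooth2_prod:
  "open \<Omega> \<Longrightarrow> (\<And>i. i \<in> I \<Longrightarrow> smooth2 \<Omega> (H i)) \<Longrightarrow> smooth2 \<Omega> (\<lambda>x y. \<Prod>i\<in>I. H i x y)"
  unfolding smooth2_def split_def by (intro smooth_on_prod open_slit)

lemmas smooth2_intros = smooth2_dx smooth2_dy smooth2_const smooth2_coord smooth2_add
  smooth2_mult smooth2_cmult smooth2_diff smooth2_power2 smooth2_divide smooth2_sum smooth2_prod

lemma smooth2_open:
  fixes \<Omega> :: "(real ^ 'n) set"
  assumes "smooth2 \<Omega> H" shows "open \<Omega>"
proof -
  have "open (\<Omega> \<times> (UNIV - {0::real ^ 'n}))" using assms by (simp add: smooth2_def smooth_on_def)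
  then have "open ((\<lambda>x. (x, axis undefined 1)) -` (\<Omega> \<times> (UNIV - {0::real ^ 'n})))"
    by (rule open_vimage) (auto intro!: continuous_intros)
  also have "(\<lambda>x. (x, axis undefined 1)) -` (\<Omega> \<times> (UNIV - {0::real ^ 'n})) = \<Omega>"
    by (auto simp: axis_eq_0_iff)
  finally show ?thesis .
qed

lemma smooth2_continuous_on:
  assumes "smooth2 \<Omega> H" "continuous_on T X" "continuous_on T Y" "\<And>t. t \<in> T \<Longrightarrow> X t \<in> \<Omega> \<and> Y t \<noteq> 0"
  shows "continuous_on T (\<lambda>t. H (X t) (Y t))"
proof -
  have "continuous_on T (\<lambda>t. (\<lambda>(x, y). H x y) (X t, Y t))"
    by (rule continuous_on_compose2[OF smooth_on_continuous[OF assms(1)[unfolded smooth2_def]]])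
      (use assms in \<open>auto intro: continuous_on_Pair\<close>)
  then show ?thesis by simp
qed

lemma dx_cong:
  assumes "open \<Omega>" "x \<in> \<Omega>" "y \<noteq> 0" "\<And>x y. x \<in> \<Omega> \<Longrightarrow> y \<noteq> 0 \<Longrightarrow> H x y = K x y"
  shows "dx k H x y = dx k K x y"
  unfolding dx_def using assms by (subst frechet_derivative_cong_open[OF assms(1,2)]) auto

lemma dy_cong:
  assumes "x \<in> \<Omega>" "y \<noteq> 0" "\<And>x y. x \<in> \<Omega> \<Longrightarrow> y \<noteq> 0 \<Longrightarrow> H x y = K x y"
  shows "dy k H x y = dy k K x y"
proof -
  have "open (UNIV - {0::real ^ 'n})" by (simp add: open_Diff)
  from frechet_derivative_cong_open[OF this, of y "\<lambda>y. H x y" "\<lambda>y. K x y"] assms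
  show ?thesis unfolding dy_def by auto
qed

context
  fixes \<Omega> :: "(real ^ 'n) set" and x y :: "real ^ 'n"
  assumes x: "x \<in> \<Omega>" and y: "y \<noteq> 0"
begin

text \<open>Smoothness supplies existence, so whatever one-variable calculus finds along the
  coordinate line is the partial derivative.\<close>

lemma dx_unique:
  "smooth2 \<Omega> H \<Longrightarrow> ((\<lambda>t. H (x + t *\<^sub>R axis k 1) y) has_real_derivative d) (at 0) \<Longrightarrow> dx k H x y = d"
  using smooth2_dx_line[OF _ x y] DERIV_unique by metis

lemma dy_unique:
  "smooth2 \<Omega> H \<Longrightarrow> ((\<lambda>t. H x (y + t *\<^sub>R axis k 1)) has_real_derivative d) (at 0) \<Longrightarrow> dy k H x y = d"
  using smooth2_dy_line[OF _ x y] DERIV_unique by metis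

lemma dx_mult:
  assumes "smooth2 \<Omega> H" "smooth2 \<Omega> K"
  shows "dx k (\<lambda>x y. H x y * K x y) x y = dx k H x y * K x y + H x y * dx k K x y"
  by (rule dx_unique[OF smooth2_mult[OF assms]])
    (auto intro!: derivative_eq_intros smooth2_dx_line[OF _ x y] assms)

lemma dy_mult:
  assumes "smooth2 \<Omega> H" "smooth2 \<Omega> K"
  shows "dy k (\<lambda>x y. H x y * K x y) x y = dy k H x y * K x y + H x y * dy k K x y"
  by (rule dy_unique[OF smooth2_mult[OF assms]])
    (auto intro!: derivative_eq_intros smooth2_dy_line[OF _ x y] assms)

lemma dy_cmult:
  assumes "smooth2 \<Omega> H" shows "dy k (\<lambda>x y. c * H x y) x y = c * dy k H x y"
  by (rule dy_unique[OF smooth2_cmult[OF assms]])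
    (auto intro!: derivative_eq_intros smooth2_dy_line[OF _ x y] assms)

lemma dx_power2:
  assumes "smooth2 \<Omega> H" shows "dx k (\<lambda>x y. (H x y)\<^sup>2) x y = 2 * H x y * dx k H x y"
  by (rule dx_unique[OF smooth2_power2[OF assms]])
    (auto intro!: derivative_eq_intros smooth2_dx_line[OF _ x y] assms)

lemma dy_power2:
  assumes "smooth2 \<Omega> H" shows "dy k (\<lambda>x y. (H x y)\<^sup>2) x y = 2 * H x y * dy k H x y"
  by (rule dy_unique[OF smooth2_power2[OF assms]])
    (auto intro!: derivative_eq_intros smooth2_dy_line[OF _ x y] assms)

lemma dy_add:
  assumes "smooth2 \<Omega> H" "smooth2 \<Omega> K"
  shows "dy k (\<lambda>x y. H x y + K x y) x y = dy k H x y + dy k K x y"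
  by (rule dy_unique[OF smooth2_add[OF assms]])
    (auto intro!: derivative_eq_intros smooth2_dy_line[OF _ x y] assms)

lemma dy_sum:
  assumes "open \<Omega>" "\<And>i. i \<in> I \<Longrightarrow> smooth2 \<Omega> (H i)"
  shows "dy k (\<lambda>x y. \<Sum>i\<in>I. H i x y) x y = (\<Sum>i\<in>I. dy k (H i) x y)"
  by (rule dy_unique[OF smooth2_sum[OF assms]])
    (auto intro!: derivative_eq_intros smooth2_dy_line[OF _ x y] assms)

lemma dx_coord: "open \<Omega> \<Longrightarrow> dx k (\<lambda>x y. y $ i) x y = 0"
  by (rule dx_unique[OF smooth2_coord]) auto

lemma dy_coord: "open \<Omega> \<Longrightarrow> dy k (\<lambda>x y. y $ i) x y = (if k = i then 1 else 0)"
  by (rule dy_unique[OF smooth2_coord])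
    (auto intro!: derivative_eq_intros simp: axis_def)

text \<open>The summand \<open>H k x y\<close> comes from differentiating the factor y itself.
  Applied to an identity for a contraction with y, the rule trades a second-order contraction for
  first-order terms.\<close>

lemma dy_contract:
  fixes H :: "'n \<Rightarrow> real ^ 'n \<Rightarrow> real ^ 'n \<Rightarrow> real"
  assumes "open \<Omega>" "\<And>j. smooth2 \<Omega> (H j)"
  shows "dy k (\<lambda>x y. \<Sum>j\<in>UNIV. H j x y * y $ j) x y = (\<Sum>j\<in>UNIV. dy k (H j) x y * y $ j) + H k x y"
proof -
  have "dy k (\<lambda>x y. \<Sum>j\<in>UNIV. H j x y * y $ j) x y
      = (\<Sum>j\<in>UNIV. dy k (H j) x y * y $ j + H j x y * (if k = j then 1 else 0))"
    by (subst dy_sum[OF assms(1)])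
      (auto intro!: smooth2_mult smooth2_coord assms sum.cong
        simp: dy_mult[OF assms(2) smooth2_coord[OF assms(1)]] dy_coord[OF assms(1)])
  then show ?thesis
    by (simp add: sum.distrib if_distrib[where f = "(*) c" for c] cong: if_cong)
qed

end

section \<open>Positively homogeneous functions and Euler's relation\<close>

lemma grad_y_homogeneous:
  assumes "smooth2 \<Omega> H" "x \<in> \<Omega>" "y \<noteq> 0" "\<And>r. r > 0 \<Longrightarrow> H x (r *\<^sub>R y) = r ^ m * H x y"
  shows "grad_y H x y y = real m * H x y"
proof -
  have "((\<lambda>t. (1 + t) *\<^sub>R y) has_vector_derivative y) (at 0)"
    by (auto intro!: derivative_eq_intros)
  from smooth2_along_curve[OF assms(1) _ _ _ this, of "\<lambda>_. x" 0] assms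
  have 1: "((\<lambda>t. H x ((1 + t) *\<^sub>R y)) has_real_derivative grad_y H x y y) (at 0)"
    by simp
  have "((\<lambda>t. (1 + t) ^ m * H x y) has_real_derivative real m * H x y) (at 0)"
    by (auto intro!: derivative_eq_intros)
  then have "((\<lambda>t. H x ((1 + t) *\<^sub>R y)) has_real_derivative real m * H x y) (at 0)"
    by (rule has_field_derivative_transform_within_open[where S="{-1<..}"]) (auto simp: assms(4))
  with 1 show ?thesis using DERIV_unique by blast
qed

text \<open>Only positive factors are allowed, since the metrics of the theorem with c nonzero are
  not reversible in y.\<close>

definition hom2 :: "(real ^ 'n) set \<Rightarrow> nat \<Rightarrow> (real ^ 'n \<Rightarrow> real ^ 'n \<Rightarrow> real) \<Rightarrow> bool" where
  "hom2 \<Omega> m H \<longleftrightarrow> (\<forall>x\<in>\<Omega>. \<forall>y. y \<noteq> 0 \<longrightarrow> (\<forall>r>0. H x (r *\<^sub>R y) = r ^ m * H x y))"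

lemma euler_hom2:
  "smooth2 \<Omega> H \<Longrightarrow> hom2 \<Omega> m H \<Longrightarrow> x \<in> \<Omega> \<Longrightarrow> y \<noteq> 0 \<Longrightarrow> grad_y H x y y = real m * H x y"
  using grad_y_homogeneous unfolding hom2_def by blast

lemma hom2_dx:
  fixes H :: "real ^ 'n \<Rightarrow> real ^ 'n \<Rightarrow> real"
  assumes s: "smooth2 \<Omega> H" and h: "hom2 \<Omega> m H" shows "hom2 \<Omega> m (dx k H)"
  unfolding hom2_def
proof (intro ballI allI impI)
  fix x y :: "real ^ 'n" and r :: real
  assume x: "x \<in> \<Omega>" and y: "y \<noteq> 0" and r: "r > 0"
  have o: "open \<Omega>" using s by (rule smooth2_open)
  have o': "open ((\<lambda>t. x + t *\<^sub>R axis k 1) -` \<Omega>)"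
    by (rule open_vimage[OF o]) (auto intro!: continuous_intros)
  have "((\<lambda>t. r ^ m * H (x + t *\<^sub>R axis k 1) y) has_real_derivative r ^ m * dx k H x y) (at 0)"
    by (auto intro!: derivative_eq_intros smooth2_dx_line[OF s x y])
  then have "((\<lambda>t. H (x + t *\<^sub>R axis k 1) (r *\<^sub>R y)) has_real_derivative r ^ m * dx k H x y) (at 0)"
    by (rule has_field_derivative_transform_within_open[OF _ o']) (use h x y r in \<open>auto simp: hom2_def\<close>)
  then show "dx k H x (r *\<^sub>R y) = r ^ m * dx k H x y"
    using dx_unique[OF x _ s] y r by simp
qed

lemma hom2_dy:
  fixes H :: "real ^ 'n \<Rightarrow> real ^ 'n \<Rightarrow> real"
  assumes s: "smooth2 \<Omega> H" and h: "hom2 \<Omega> (Suc m) H" shows "hom2 \<Omega> m (dy k H)"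
  unfolding hom2_def
proof (intro ballI allI impI)
  fix x y :: "real ^ 'n" and r :: real
  assume x: "x \<in> \<Omega>" and y: "y \<noteq> 0" and r: "r > 0"
  have o': "open ((\<lambda>t::real. y + t *\<^sub>R axis k 1) -` (UNIV - {0}))"
    by (rule open_vimage) (auto intro!: continuous_intros open_Diff)
  have "((\<lambda>t. r *\<^sub>R (y + t *\<^sub>R axis k 1)) has_vector_derivative r *\<^sub>R axis k 1) (at 0)"
    by (auto intro!: derivative_eq_intros)
  from smooth2_along_curve[OF s _ _ _ this, of "\<lambda>_. x" 0] x y r
  have 1: "((\<lambda>t. H x (r *\<^sub>R (y + t *\<^sub>R axis k 1))) has_real_derivative r * dy k H x (r *\<^sub>R y)) (at 0)"
    by (simp add: mult.left_commute[of _ r] flip: sum_distrib_left)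
  have "((\<lambda>t. r ^ Suc m * H x (y + t *\<^sub>R axis k 1)) has_real_derivative r ^ Suc m * dy k H x y) (at 0)"
    by (rule DERIV_cmult[OF smooth2_dy_line[OF s x y]])
  then have "((\<lambda>t. H x (r *\<^sub>R (y + t *\<^sub>R axis k 1))) has_real_derivative r ^ Suc m * dy k H x y) (at 0)"
    by (rule has_field_derivative_transform_within_open[OF _ o']) (use h x y r in \<open>auto simp: hom2_def\<close>)
  with 1 have "r * dy k H x (r *\<^sub>R y) = r ^ Suc m * dy k H x y" using DERIV_unique by blast
  then show "dy k H x (r *\<^sub>R y) = r ^ m * dy k H x y" using r by simp
qed

section \<open>Ordinary differential equations\<close>

text \<open>Integrating factor: h exp(-B) has zero derivative when B is an antiderivative of
  \<beta>. It serves for the straightness of curves with acceleration parallel to velocity and for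
  the constancy of P along characteristics.\<close>

lemma linear_ode_zero:
  fixes h \<beta> :: "real \<Rightarrow> real"
  assumes cont: "continuous_on {c..d} \<beta>"
    and ode: "\<And>t. t \<in> {c..d} \<Longrightarrow> (h has_real_derivative \<beta> t * h t) (at t within {c..d})"
    and zero: "t0 \<in> {c..d}" "h t0 = 0" and t: "t \<in> {c..d}"
  shows "h t = 0"
proof -
  define B where "B = (\<lambda>u. integral {c..u} \<beta>)"
  have B: "(B has_real_derivative \<beta> s) (at s within {c..d})" if "s \<in> {c..d}" for s
    unfolding B_def by (rule integral_has_real_derivative[OF cont that])
  have "((\<lambda>s. h s * exp (- B s)) has_real_derivative 0) (at s within {c..d})" if "s \<in> {c..d}" for s
    by (auto intro!: derivative_eq_intros ode[OF that] B[OF that])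
  then obtain k where k: "\<And>s. s \<in> {c..d} \<Longrightarrow> h s * exp (- B s) = k"
    using has_field_derivative_zero_constant[of "{c..d}" "\<lambda>s. h s * exp (- B s)"] by auto
  from k[OF zero(1)] zero(2) have "k = 0" by simp
  with k[OF t] show ?thesis by simp
qed

text \<open>Parallelism tested against all normals w, which reduces statements about vector curves
  to scalar ones. For u = 0 division by zero yields the coefficient 0, and the argument still
  holds.\<close>

lemma scaleR_if_orthogonal:
  fixes u v :: "'a::real_inner"
  assumes "\<And>w. w \<bullet> u = 0 \<Longrightarrow> w \<bullet> v = 0"
  obtains c where "v = c *\<^sub>R u"
proof -
  define w where "w = v - ((v \<bullet> u) / (u \<bullet> u)) *\<^sub>R u"
  have "w \<bullet> u = 0" by (cases "u = 0") (auto simp: w_def inner_diff_left)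
  then have "w \<bullet> v = 0" "w \<bullet> u = 0" using assms by auto
  then have "w \<bullet> w = 0" by (simp add: w_def inner_diff_right)
  then have "v = ((v \<bullet> u) / (u \<bullet> u)) *\<^sub>R u" by (simp add: w_def)
  then show thesis by (rule that)
qed

text \<open>Picard--Lindeloef: the integral operator is a contraction on curves in the ball.\<close>

lemma ode_local_existence:
  fixes X :: "'a::euclidean_space \<Rightarrow> 'a"
  assumes e: "e > 0"
    and lip: "\<And>u v. u \<in> cball w0 e \<Longrightarrow> v \<in> cball w0 e \<Longrightarrow> norm (X u - X v) \<le> L * norm (u - v)"
  obtains \<epsilon> \<sigma> where "\<epsilon> > 0" "\<sigma> 0 = w0"
    "\<forall>t\<in>{-\<epsilon><..<\<epsilon>}. \<sigma> t \<in> cball w0 e \<and> (\<sigma> has_vector_derivative X (\<sigma> t)) (at t)"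
proof -
  define K where "K = max L 0"
  define M where "M = norm (X w0) + K * e"
  \<comment> \<open>The first bound keeps the iterates in the ball, the second makes the contraction
    constant 1/2. The factor 4 appears because \<open>J\<close> contains two integrals, each over an
    interval of length at most 2 \<epsilon>.\<close>
  define \<epsilon> where "\<epsilon> = min (e / (4 * (M + 1))) (1 / (8 * (K + 1)))"
  have K: "K \<ge> 0" "L \<le> K" by (auto simp: K_def)
  have M: "M \<ge> 0" using K e by (simp add: M_def)
  have \<epsilon>: "\<epsilon> > 0" using e K M by (simp add: \<epsilon>_def)
  have \<epsilon>M: "4 * \<epsilon> * M \<le> e"
  proof -
    have "\<epsilon> \<le> e / (4 * (M + 1))" by (simp add: \<epsilon>_def)
    then have "\<epsilon> * (4 * (M + 1)) \<le> e" using M by (simp add: pos_le_divide_eq)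
    then show ?thesis using \<epsilon> by (simp add: algebra_simps)
  qed
  have \<epsilon>K: "4 * \<epsilon> * K \<le> 1/2"
  proof -
    have "\<epsilon> \<le> 1 / (8 * (K + 1))" by (simp add: \<epsilon>_def)
    then have "\<epsilon> * (8 * (K + 1)) \<le> 1" using K by (simp add: field_simps)
    then show ?thesis using \<epsilon> by (simp add: algebra_simps)
  qed
  have lipK: "norm (X u - X v) \<le> K * norm (u - v)" if "u \<in> cball w0 e" "v \<in> cball w0 e" for u v
    using lip[OF that] mult_right_mono[OF K(2), of "norm (u - v)"] by simp
  have XM: "norm (X u) \<le> M" if "u \<in> cball w0 e" for u
  proof -
    have "norm (X u) \<le> norm (X w0) + norm (X u - X w0)" by norm
    also have "norm (X u - X w0) \<le> K * norm (u - w0)" using that e by (intro lipK) auto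
    also have "\<dots> \<le> K * e" using that K by (intro mult_left_mono) (auto simp: dist_norm norm_minus_commute)
    finally show ?thesis by (simp add: M_def)
  qed
  have contX: "continuous_on (cball w0 e) X"
    by (rule lipschitz_on_continuous_on[of K]) (auto intro!: lipschitz_onI simp: dist_norm lipK K)
  let ?I = "{-\<epsilon>..\<epsilon>}"
  \<comment> \<open>Bounded continuous curves on the whole real line form a complete metric space;
    only their values on the interval \<open>?I\<close> matter.\<close>
  define S where "S = PiC (UNIV :: real set) (\<lambda>_. cball w0 e)"
  \<comment> \<open>The integral from 0 to t, written as a difference of integrals from the left
    endpoint so that negative t needs no separate treatment.\<close>
  define J where "J = (\<lambda>(u :: real \<Rightarrow>\<^sub>C 'a) t. w0 + (integral {-\<epsilon>..t} (\<lambda>s. X (u s)) - integral {-\<epsilon>..0} (\<lambda>s. X (u s))))"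
  have S: "u t \<in> cball w0 e" if "u \<in> S" for u t using that by (auto simp: S_def mem_PiC_iff)
  have contXu: "continuous_on A (\<lambda>s. X (u s))" if "u \<in> S" for u A
    using S[OF that] by (intro continuous_on_compose2[OF contX]) (auto intro!: continuous_intros)
  have Jderiv: "(J u has_vector_derivative X (u t)) (at t within ?I)" if "u \<in> S" "t \<in> ?I" for u t
    unfolding J_def
    by (auto intro!: derivative_eq_intros integral_has_vector_derivative contXu that simp del: atLeastAtMost_iff)
  have Jcont: "continuous_on (cbox (-\<epsilon>) \<epsilon>) (J u)" if "u \<in> S" for u
    unfolding cbox_interval continuous_on_eq_continuous_within
    by (intro ballI has_vector_derivative_continuous[OF Jderiv[OF that]])
  \<comment> \<open>\<open>clamp\<close> freezes \<open>J u\<close> outside the interval, which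
    makes it a bounded continuous function on the line again.\<close>
  have "\<exists>g :: real \<Rightarrow>\<^sub>C 'a. \<forall>t. g t = J u (clamp (-\<epsilon>) \<epsilon> t)" if "u \<in> S" for u
    using continuous_on_cbox_bcontfunE[OF Jcont[OF that]] by metis
  then obtain T :: "(real \<Rightarrow>\<^sub>C 'a) \<Rightarrow> (real \<Rightarrow>\<^sub>C 'a)"
    where T: "\<And>u t. u \<in> S \<Longrightarrow> T u t = J u (clamp (-\<epsilon>) \<epsilon> t)" by metis
  have clamp: "clamp (-\<epsilon>) \<epsilon> t \<in> ?I" for t
    using clamp_in_interval[of "-\<epsilon>" \<epsilon> t] \<epsilon> by (simp add: cbox_interval)
  have bound: "norm (integral {-\<epsilon>..t} f - integral {-\<epsilon>..0} f) \<le> 4 * \<epsilon> * B"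
    if "continuous_on ?I f" "\<And>s. norm (f s) \<le> B" "t \<in> ?I" "B \<ge> 0" for f :: "real \<Rightarrow> 'a" and B t
  proof -
    have *: "norm (integral {-\<epsilon>..s} f) \<le> 2 * \<epsilon> * B" if "s \<in> ?I" for s
    proof -
      have "norm (integral {-\<epsilon>..s} f) \<le> B * (s - (-\<epsilon>))"
        using that \<open>continuous_on ?I f\<close>
        by (intro integral_bound \<open>norm (f _) \<le> B\<close>) (auto elim: continuous_on_subset)
      also have "\<dots> \<le> B * (2 * \<epsilon>)" using that \<open>B \<ge> 0\<close> by (intro mult_left_mono) auto
      finally show ?thesis by (simp add: mult.commute)
    qed
    have "norm (integral {-\<epsilon>..t} f - integral {-\<epsilon>..0} f)
        \<le> norm (integral {-\<epsilon>..t} f) + norm (integral {-\<epsilon>..0} f)"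
      by (rule norm_triangle_ineq4)
    also have "\<dots> \<le> 2 * \<epsilon> * B + 2 * \<epsilon> * B"
      using *[OF \<open>t \<in> ?I\<close>] *[of 0] \<epsilon> by (intro add_mono) auto
    finally show ?thesis by (simp add: mult.commute)
  qed
  have "\<exists>!u\<in>S. T u = u"
  proof (rule Banach_fix[where c = "1/2"])
    show "complete S" unfolding complete_eq_closed S_def by (rule closed_PiC) simp
    have "const_bcontfun w0 \<in> S" using e by (simp add: S_def mem_PiC_iff)
    then show "S \<noteq> {}" by blast
    show "T ` S \<subseteq> S"
    proof clarify
      fix u assume u: "u \<in> S"
      have "T u t \<in> cball w0 e" for t
      proof -
        have "dist w0 (T u t) \<le> 4 * \<epsilon> * M"
          unfolding T[OF u] J_def dist_norm
          using bound[OF contXu[OF u] XM[OF S[OF u]] clamp[of t] M] by (simp add: norm_minus_commute)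
        then show ?thesis using \<epsilon>M by simp
      qed
      then show "T u \<in> S" by (simp add: S_def mem_PiC_iff)
    qed
    show "dist (T u) (T v) \<le> 1/2 * dist u v" if u: "u \<in> S" and v: "v \<in> S" for u v
    proof (rule dist_bound)
      fix t
      let ?f = "\<lambda>s. X (u s) - X (v s)" and ?c = "clamp (-\<epsilon>) \<epsilon> t"
      have nb: "norm (?f s) \<le> K * dist u v" for s
      proof -
        have "norm (?f s) \<le> K * norm (u s - v s)" by (rule lipK) (use S u v in auto)
        also have "\<dots> \<le> K * dist u v"
          using dist_bounded[of u s v] K by (intro mult_left_mono) (auto simp: dist_norm)
        finally show ?thesis .
      qed
      have "integral {-\<epsilon>..s} ?f = integral {-\<epsilon>..s} (\<lambda>s. X (u s)) - integral {-\<epsilon>..s} (\<lambda>s. X (v s))" for s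
        by (rule integral_diff) (auto intro!: integrable_continuous_real contXu u v)
      then have "dist (T u t) (T v t) = norm (integral {-\<epsilon>..?c} ?f - integral {-\<epsilon>..0} ?f)"
        unfolding T[OF u] T[OF v] J_def dist_norm
        by (simp only:) (simp add: algebra_simps)
      also have "\<dots> \<le> 4 * \<epsilon> * (K * dist u v)"
        by (rule bound[OF _ nb clamp]) (auto intro!: continuous_intros contXu u v K mult_nonneg_nonneg)
      also have "\<dots> = (4 * \<epsilon> * K) * dist u v" by simp
      also have "\<dots> \<le> 1/2 * dist u v" using \<epsilon>K by (intro mult_right_mono) auto
      finally show "dist (T u t) (T v t) \<le> 1/2 * dist u v" .
    qed
  qed auto
  then obtain u where u: "u \<in> S" "T u = u" by blast
  have uJ: "u t = J u t" if "t \<in> ?I" for t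
    using T[OF u(1), of t] u(2) that by (simp add: cbox_interval)
  show thesis
  proof (rule that[OF \<epsilon>, of u])
    show "u 0 = w0" using uJ[of 0] \<epsilon> by (simp add: J_def)
    show "\<forall>t\<in>{-\<epsilon><..<\<epsilon>}. u t \<in> cball w0 e \<and> (u has_vector_derivative X (u t)) (at t)"
    proof (intro ballI conjI)
      fix t assume t: "t \<in> {-\<epsilon><..<\<epsilon>}"
      show "u t \<in> cball w0 e" by (rule S[OF u(1)])
      have "(J u has_vector_derivative X (u t)) (at t)"
        using Jderiv[OF u(1), of t] t at_within_Icc_at[of "-\<epsilon>" t \<epsilon>] by auto
      then show "(u has_vector_derivative X (u t)) (at t)"
        by (rule has_vector_derivative_transform_within_open[where S="{-\<epsilon><..<\<epsilon>}"]) (use t uJ in auto)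
    qed
  qed
qed

section \<open>Projectively flat Finsler metrics\<close>

text \<open>The determinant is a polynomial in the entries. This is used with Cramer's rule for the
  spray coefficients.\<close>

lemma smooth2_det:
  fixes A :: "'m::finite \<Rightarrow> 'm \<Rightarrow> real ^ 'n \<Rightarrow> real ^ 'n \<Rightarrow> real"
  assumes "open \<Omega>" "\<And>i j. smooth2 \<Omega> (A i j)"
  shows "smooth2 \<Omega> (\<lambda>x y. det (\<chi> i j. A i j x y))"
  unfolding det_def
  by (intro smooth2_sum smooth2_cmult smooth2_prod assms | simp add: assms)+

locale finsler_domain =
  fixes \<Omega> :: "(real ^ 'n) set" and F :: "real ^ 'n \<Rightarrow> real ^ 'n \<Rightarrow> real"
  assumes open_dom: "open \<Omega>" and finsler: "finsler_metric \<Omega> F"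
begin

definition proj_factor :: "real ^ 'n \<Rightarrow> real ^ 'n \<Rightarrow> real" where
  "proj_factor x y = grad_x F x y y / (2 * F x y)"

abbreviation "L \<equiv> \<lambda>x y. (F x y)\<^sup>2"
abbreviation "E \<equiv> \<lambda>x y. (F x y)\<^sup>2 / 2"
abbreviation "P \<equiv> proj_factor"
abbreviation "G \<equiv> geod_coeff F"

lemma smooth_F: "smooth2 \<Omega> F"
  using finsler by (simp add: finsler_metric_def smooth2_def)

lemma F_pos: "x \<in> \<Omega> \<Longrightarrow> y \<noteq> 0 \<Longrightarrow> F x y > 0"
  using finsler unfolding finsler_metric_def by (metis order_le_less)

lemma F_zero: "x \<in> \<Omega> \<Longrightarrow> F x 0 = 0"
  using finsler unfolding finsler_metric_def by blast

lemma hom_F: "hom2 \<Omega> (Suc 0) F"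
  using finsler by (simp add: finsler_metric_def hom2_def)

lemma smooth_L: "smooth2 \<Omega> L" by (rule smooth2_power2[OF smooth_F])

lemma smooth_E: "smooth2 \<Omega> E"
  using smooth2_cmult[OF smooth_L, of "1/2"] by simp

lemma hom_L: "hom2 \<Omega> (Suc (Suc 0)) L"
  using hom_F by (auto simp: hom2_def power2_eq_square)

lemma hom_E: "hom2 \<Omega> (Suc (Suc 0)) E"
  using hom_F by (auto simp: hom2_def power2_eq_square)

lemma smooth_P: "smooth2 \<Omega> P"
  unfolding proj_factor_def
  by (intro smooth2_intros smooth_F open_dom) (use F_pos in force)

lemma hom_P: "hom2 \<Omega> (Suc 0) P"
  unfolding hom2_def
proof (intro ballI allI impI)
  fix x y :: "real ^ 'n" and r :: real assume xy: "x \<in> \<Omega>" "y \<noteq> 0" and r: "r > 0"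
  have "F x (r *\<^sub>R y) = r * F x y" "\<And>k. dx k F x (r *\<^sub>R y) = r * dx k F x y"
    using hom_F hom2_dx[OF smooth_F hom_F] xy r by (auto simp: hom2_def)
  moreover from this have "grad_x F x (r *\<^sub>R y) (r *\<^sub>R y) = r * (r * grad_x F x y y)"
    by (simp add: sum_distrib_left mult_ac)
  ultimately show "P x (r *\<^sub>R y) = r ^ Suc 0 * P x y"
    using r by (simp add: proj_factor_def)
qed

lemma smooth_fund: "smooth2 \<Omega> (\<lambda>x y. fund_tensor F x y $ i $ j)"
  unfolding fund_tensor_def by (simp add: smooth2_dy smooth_E)

text \<open>The bracket in \<open>geod_coeff\<close>, kept apart so that the matrix inverse can be
  traded for the linear system \<open>fund_G\<close>.\<close>

definition spray_rhs :: "real ^ 'n \<Rightarrow> real ^ 'n \<Rightarrow> real ^ 'n" where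
  "spray_rhs x y = (\<chi> l. (\<Sum>m\<in>UNIV. dy l (dx m L) x y * y $ m) - dx l L x y)"

lemma smooth_spray_rhs: "smooth2 \<Omega> (\<lambda>x y. spray_rhs x y $ l)"
  unfolding spray_rhs_def vec_lambda_beta
  by (intro smooth2_intros smooth_L open_dom)

context
  fixes x y :: "real ^ 'n" assumes x: "x \<in> \<Omega>" and y: "y \<noteq> 0"
begin

lemma fund_pos: "u \<noteq> 0 \<Longrightarrow> u \<bullet> (fund_tensor F x y *v u) > 0"
  using finsler x y
  by (simp add: finsler_metric_def inner_vec_def matrix_vector_mult_def sum_distrib_left mult.left_commute mult.commute)

lemma fund_ker: "fund_tensor F x y *v u = 0 \<Longrightarrow> u = 0"
  using fund_pos by fastforce

lemma invertible_fund: "invertible (fund_tensor F x y)"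
  using fund_ker by (simp add: invertible_left_inverse matrix_left_invertible_ker)

lemma matrix_inv_fund:
  "matrix_inv (fund_tensor F x y) *v w = v \<longleftrightarrow> fund_tensor F x y *v v = w"
proof -
  have *: "fund_tensor F x y ** matrix_inv (fund_tensor F x y) = mat 1
      \<and> matrix_inv (fund_tensor F x y) ** fund_tensor F x y = mat 1"
    unfolding matrix_inv_def using invertible_fund[unfolded invertible_def] by (rule someI_ex)
  show ?thesis
    using * by (metis matrix_vector_mul_assoc matrix_vector_mul_lid)
qed

lemma fund_G: "fund_tensor F x y *v (\<chi> i. 4 * G i x y) = spray_rhs x y"
proof -
  have "(\<chi> i. 4 * G i x y) = matrix_inv (fund_tensor F x y) *v spray_rhs x y"
    by (simp add: geod_coeff_def spray_rhs_def matrix_vector_mult_def vec_eq_iff)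
  then show ?thesis using matrix_inv_fund by metis
qed

text \<open>Euler's relation for the derivative of F^2/2, which has degree 1. It makes the
  fundamental tensor applied to y a first-order expression in F.\<close>

lemma fund_y: "(fund_tensor F x y *v y) $ l = F x y * dy l F x y"
proof -
  have "(fund_tensor F x y *v y) $ l = grad_y (dy l E) x y y"
    by (simp add: fund_tensor_def matrix_vector_mult_def)
  also have "\<dots> = dy l E x y"
    using euler_hom2[OF smooth2_dy[OF smooth_E] hom2_dy[OF smooth_E hom_E] x y] by simp
  also have "\<dots> = dy l (\<lambda>x y. 1/2 * L x y) x y" by simp
  also have "\<dots> = F x y * dy l F x y"
    unfolding dy_cmult[OF x y smooth_L] by (simp add: dy_power2[OF x y smooth_F])
  finally show ?thesis .
qed

text \<open>Contracting the spray equation with \<open>y\<close> identifies the factor.\<close>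

lemma parallel_factor:
  assumes "\<And>i. G i x y = c * y $ i"
  shows "c = P x y"
proof -
  have "(\<chi> i. 4 * G i x y) = (4 * c) *\<^sub>R y" by (simp add: vec_eq_iff assms)
  then have w: "spray_rhs x y $ l = 4 * c * (F x y * dy l F x y)" for l
    unfolding fund_G[symmetric] by (simp add: matrix_vector_mult_scaleR fund_y)
  have "(\<Sum>l\<in>UNIV. spray_rhs x y $ l * y $ l) = 4 * c * F x y * grad_y F x y y"
    by (simp add: w sum_distrib_left mult_ac)
  also have "grad_y F x y y = F x y" using euler_hom2[OF smooth_F hom_F x y] by simp
  finally have 1: "(\<Sum>l\<in>UNIV. spray_rhs x y $ l * y $ l) = 4 * c * (F x y)\<^sup>2"
    by (simp add: power2_eq_square)
  have "(\<Sum>l\<in>UNIV. spray_rhs x y $ l * y $ l)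
      = (\<Sum>l\<in>UNIV. \<Sum>m\<in>UNIV. dy l (dx m L) x y * y $ m * y $ l) - grad_x L x y y"
    by (simp add: spray_rhs_def left_diff_distrib sum_subtractf sum_distrib_right)
  also have "(\<Sum>l\<in>UNIV. \<Sum>m\<in>UNIV. dy l (dx m L) x y * y $ m * y $ l)
      = (\<Sum>m\<in>UNIV. grad_y (dx m L) x y y * y $ m)"
    by (subst sum.swap) (simp add: sum_distrib_left sum_distrib_right mult_ac)
  \<comment> \<open>\<open>dx m L\<close> is still homogeneous of degree 2, so Euler doubles this
    term; the subtracted x-gradient then leaves one copy.\<close>
  also have "\<dots> = (\<Sum>m\<in>UNIV. 2 * dx m L x y * y $ m)"
    using euler_hom2[OF smooth2_dx[OF smooth_L] hom2_dx[OF smooth_L hom_L] x y] by simp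
  finally have "(\<Sum>l\<in>UNIV. spray_rhs x y $ l * y $ l) = grad_x L x y y"
    by (simp add: sum_distrib_left mult.commute flip: sum_subtractf)
  also have "\<dots> = 2 * F x y * grad_x F x y y"
    by (simp add: dx_power2[OF x y smooth_F] sum_distrib_left mult_ac)
  finally have "2 * F x y * grad_x F x y y = 4 * c * (F x y)\<^sup>2" using 1 by simp
  then show ?thesis using F_pos[OF x y] by (simp add: proj_factor_def field_simps power2_eq_square)
qed

text \<open>By the definition of P, the x-derivative of L in direction y is 4 P L. Differentiating
  this in y^l gives the mixed term of the spray plus one extra \<open>dx l L\<close>; the minus sign
  in \<open>spray_rhs\<close> accounts for the second.\<close>

lemma spray_rhs_eq:
  "spray_rhs x y $ l + 2 * dx l L x y = 4 * (dy l P x y * L x y + 2 * P x y * F x y * dy l F x y)"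
proof -
  have "dy l (\<lambda>x y. \<Sum>m\<in>UNIV. dx m L x y * y $ m) x y = dy l (\<lambda>x y. 4 * (P x y * L x y)) x y"
  proof (rule dy_cong[OF x y])
    fix x y assume xy: "x \<in> \<Omega>" "y \<noteq> (0 :: real ^ 'n)"
    have "grad_x L x y y = 2 * F x y * grad_x F x y y"
      by (simp add: dx_power2[OF xy smooth_F] sum_distrib_left mult_ac)
    then show "grad_x L x y y = 4 * (P x y * L x y)"
      using F_pos[OF xy] by (simp add: proj_factor_def power2_eq_square)
  qed
  also have "\<dots> = 4 * (dy l P x y * L x y + P x y * (2 * F x y * dy l F x y))"
    by (simp add: dy_cmult[OF x y smooth2_mult[OF smooth_P smooth_L]] dy_mult[OF x y smooth_P smooth_L]
        dy_power2[OF x y smooth_F])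
  also have "dy l (\<lambda>x y. \<Sum>m\<in>UNIV. dx m L x y * y $ m) x y
      = (\<Sum>m\<in>UNIV. dy l (dx m L) x y * y $ m) + dx l L x y"
    by (rule dy_contract[OF x y open_dom smooth2_dx[OF smooth_L]])
  finally show ?thesis by (simp add: spray_rhs_def)
qed

text \<open>Hamel's condition, in the form \<open>F\<^sub>x = (P F)\<^sub>y\<close>.\<close>

lemma parallel_iff:
  "(\<forall>i. G i x y = P x y * y $ i) \<longleftrightarrow> (\<forall>l. dx l F x y = dy l P x y * F x y + P x y * dy l F x y)"
proof -
  have "(\<forall>i. G i x y = P x y * y $ i) \<longleftrightarrow> (\<chi> i. 4 * G i x y) = (4 * P x y) *\<^sub>R y"
    by (simp add: vec_eq_iff)
  also have "\<dots> \<longleftrightarrow> fund_tensor F x y *v ((4 * P x y) *\<^sub>R y) = spray_rhs x y"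
    using fund_G matrix_inv_fund by metis
  also have "\<dots> \<longleftrightarrow> (\<forall>l. spray_rhs x y $ l = 4 * P x y * (F x y * dy l F x y))"
    by (auto simp: vec_eq_iff matrix_vector_mult_scaleR fund_y)
  also have "\<dots> \<longleftrightarrow> (\<forall>l. 2 * F x y * (dx l F x y - (dy l P x y * F x y + P x y * dy l F x y)) = 0)"
  proof (rule all_cong1)
    fix l
    show "spray_rhs x y $ l = 4 * P x y * (F x y * dy l F x y) \<longleftrightarrow>
      2 * F x y * (dx l F x y - (dy l P x y * F x y + P x y * dy l F x y)) = 0"
      using spray_rhs_eq[of l] unfolding dx_power2[OF x y smooth_F]
      by (simp only: power2_eq_square) (auto simp: algebra_simps)
  qed
  also have "\<dots> \<longleftrightarrow> (\<forall>l. dx l F x y = dy l P x y * F x y + P x y * dy l F x y)"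
    using F_pos[OF x y] by simp
  finally show ?thesis .
qed

end

section \<open>Existence of geodesics, and straightness against G = P y\<close>

lemma smooth_G: "smooth2 \<Omega> (G i)"
proof -
  let ?A = "\<lambda>x y. fund_tensor F x y"
  \<comment> \<open>Cramer's rule: G is a quotient of determinants with smooth entries, and positive
    definiteness keeps the denominator away from zero.\<close>
  have "smooth2 \<Omega> (\<lambda>x y. (1/4) * (det (\<chi> k j. if j = i then spray_rhs x y $ k else ?A x y $ k $ j)
      / det (\<chi> k j. ?A x y $ k $ j)))"
  proof (intro smooth2_cmult smooth2_divide smooth2_det open_dom smooth_fund)
    fix k j
    show "smooth2 \<Omega> (\<lambda>x y. if j = i then spray_rhs x y $ k else fund_tensor F x y $ k $ j)"
      by (cases "j = i") (simp_all add: smooth_spray_rhs smooth_fund)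
    fix x y assume "x \<in> \<Omega>" "y \<noteq> (0 :: real ^ 'n)"
    from invertible_fund[OF this] show "det (\<chi> k j. ?A x y $ k $ j) \<noteq> 0"
      by (simp add: invertible_det_nz)
  qed
  also have "?this \<longleftrightarrow> ?thesis"
  proof (rule smooth2_cong)
    fix x y assume xy: "x \<in> \<Omega>" "y \<noteq> (0 :: real ^ 'n)"
    from invertible_fund[OF xy] have d: "det (?A x y) \<noteq> 0" by (simp add: invertible_det_nz)
    have "(\<chi> i. 4 * G i x y) = (\<chi> i. det (\<chi> k j. if j = i then spray_rhs x y $ k else ?A x y $ k $ j) / det (?A x y))"
      using fund_G[OF xy] unfolding cramer[OF d] .
    then have "4 * G i x y = det (\<chi> k j. if j = i then spray_rhs x y $ k else ?A x y $ k $ j) / det (?A x y)"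
      by (simp add: vec_eq_iff)
    then show "(1/4) * (det (\<chi> k j. if j = i then spray_rhs x y $ k else ?A x y $ k $ j)
      / det (\<chi> k j. ?A x y $ k $ j)) = G i x y" by simp
  qed
  finally show ?thesis .
qed

text \<open>The geodesic equation is read as a first-order system for the pair (position, velocity).
  Solutions stay in a ball inside the open set of pairs with nonzero velocity.\<close>

lemma geodesic_exists:
  assumes x: "x \<in> \<Omega>" and y: "y \<noteq> 0"
  obtains \<epsilon> \<sigma> \<sigma>' where "\<epsilon> > 0" "\<sigma> 0 = x" "\<sigma>' 0 = y"
    "\<forall>t\<in>{-\<epsilon><..<\<epsilon>}. \<sigma> t \<in> \<Omega> \<and> \<sigma>' t \<noteq> 0 \<and> (\<sigma> has_vector_derivative \<sigma>' t) (at t) \<and>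
        (\<sigma>' has_vector_derivative (\<chi> i. - 2 * G i (\<sigma> t) (\<sigma>' t))) (at t)"
proof -
  let ?S = "\<Omega> \<times> (UNIV - {0 :: real ^ 'n})"
  \<comment> \<open>The vector field as a linear map plus scalar functions times constant vectors,
    the shape to which the smoothness rules apply.\<close>
  define X :: "(real ^ 'n) \<times> (real ^ 'n) \<Rightarrow> (real ^ 'n) \<times> (real ^ 'n)"
    where "X = (\<lambda>w. (snd w, 0) + (\<Sum>i\<in>UNIV. G i (fst w) (snd w) *\<^sub>R (0 :: real ^ 'n, axis i (-2))))"
  have X: "X w = (snd w, \<chi> i. - 2 * G i (fst w) (snd w))" for w
    unfolding X_def
    by (auto simp: vec_eq_iff axis_def prod_eq_iff fst_sum snd_sum if_distrib cong: if_cong)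
  have 1: "smooth_on ?S (\<lambda>w. (snd w, 0 :: real ^ 'n))"
    by (intro smooth_on_bounded_linear open_slit open_dom bounded_linear_Pair bounded_linear_snd bounded_linear_zero)
  have 2: "smooth_on ?S (\<lambda>w. G i (fst w) (snd w) *\<^sub>R (0 :: real ^ 'n, axis i (-2)))" for i
    using smooth_G[of i] unfolding smooth2_def split_def
    by (rule smooth_on_linear_compose[OF bounded_linear_scaleR_left])
  have "smooth_on ?S X"
    unfolding X_def by (intro smooth_on_add smooth_on_sum open_slit open_dom 1 2)
  then obtain e K where e: "e > 0" "cball (x, y) e \<subseteq> ?S"
    "\<And>u v. u \<in> cball (x, y) e \<Longrightarrow> v \<in> cball (x, y) e \<Longrightarrow> norm (X u - X v) \<le> K * norm (u - v)"
    using smooth_on_locally_lipschitz[of ?S X "(x, y)"] x y by auto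
  obtain \<epsilon> \<sigma> where s: "\<epsilon> > 0" "\<sigma> 0 = (x, y)"
    "\<forall>t\<in>{-\<epsilon><..<\<epsilon>}. \<sigma> t \<in> cball (x, y) e \<and> (\<sigma> has_vector_derivative X (\<sigma> t)) (at t)"
    using ode_local_existence[OF e(1,3)] by blast
  show thesis
  proof (rule that[of \<epsilon> "\<lambda>t. fst (\<sigma> t)" "\<lambda>t. snd (\<sigma> t)"])
    show "\<forall>t\<in>{-\<epsilon><..<\<epsilon>}. fst (\<sigma> t) \<in> \<Omega> \<and> snd (\<sigma> t) \<noteq> 0 \<and>
        ((\<lambda>t. fst (\<sigma> t)) has_vector_derivative snd (\<sigma> t)) (at t) \<and>
        ((\<lambda>t. snd (\<sigma> t)) has_vector_derivative (\<chi> i. - 2 * G i (fst (\<sigma> t)) (snd (\<sigma> t)))) (at t)"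
    proof
      fix t assume t: "t \<in> {-\<epsilon><..<\<epsilon>}"
      have d: "(\<sigma> has_vector_derivative X (\<sigma> t)) (at t)" using s(3) t by blast
      have "\<sigma> t \<in> ?S" using s(3) t e(2) by blast
      with bounded_linear.has_vector_derivative[OF bounded_linear_fst d]
        bounded_linear.has_vector_derivative[OF bounded_linear_snd d]
      show "fst (\<sigma> t) \<in> \<Omega> \<and> snd (\<sigma> t) \<noteq> 0 \<and>
        ((\<lambda>t. fst (\<sigma> t)) has_vector_derivative snd (\<sigma> t)) (at t) \<and>
        ((\<lambda>t. snd (\<sigma> t)) has_vector_derivative (\<chi> i. - 2 * G i (fst (\<sigma> t)) (snd (\<sigma> t)))) (at t)"
        by (auto simp: X)
    qed
  qed (use s in auto)
qed

text \<open>A geodesic contained in a line has both velocity and acceleration along that line. At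
  time 0 this makes G a multiple of y, and \<open>parallel_factor\<close> identifies the
  multiple.\<close>

lemma projectively_flat_imp_parallel:
  assumes flat: "projectively_flat \<Omega> F" and x: "x \<in> \<Omega>" and y: "y \<noteq> 0"
  shows "G i x y = P x y * y $ i"
proof -
  obtain \<epsilon> \<sigma> \<sigma>' where s: "\<epsilon> > 0" "\<sigma> 0 = x" "\<sigma>' 0 = y" and
    d': "\<forall>t\<in>{-\<epsilon><..<\<epsilon>}. \<sigma> t \<in> \<Omega> \<and> \<sigma>' t \<noteq> 0 \<and> (\<sigma> has_vector_derivative \<sigma>' t) (at t) \<and>
        (\<sigma>' has_vector_derivative (\<chi> i. - 2 * G i (\<sigma> t) (\<sigma>' t))) (at t)"
    using geodesic_exists[OF x y] by blast
  let ?I = "{-\<epsilon><..<\<epsilon>}"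
  note d = bspec[OF d']
  have "finsler_geodesic \<Omega> F (-\<epsilon>) \<epsilon> \<sigma>" unfolding finsler_geodesic_def using d by blast
  then have "collinear (\<sigma> ` ?I)" using flat unfolding projectively_flat_def by blast
  then obtain u where "\<forall>p\<in>\<sigma> ` ?I. \<forall>q\<in>\<sigma> ` ?I. \<exists>c. p - q = c *\<^sub>R u"
    unfolding collinear_def by blast
  then have u: "\<exists>c. \<sigma> s - \<sigma> t = c *\<^sub>R u" if "s \<in> ?I" "t \<in> ?I" for s t
    using that by blast
  \<comment> \<open>Along the curve the inner product with a normal w of the line is constant;
    differentiating once handles the velocity, and once more, in \<open>acc\<close>, the
    acceleration.\<close>
  have vel: "w \<bullet> \<sigma>' t = 0" if wu: "w \<bullet> u = 0" and tI: "t \<in> ?I" for w t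
  proof -
    have "((\<lambda>s. w \<bullet> \<sigma> s) has_vector_derivative w \<bullet> \<sigma>' t) (at t)"
      using d[OF that(2)] by (intro bounded_linear.has_vector_derivative[OF bounded_linear_inner_right]) auto
    moreover have "((\<lambda>s. w \<bullet> \<sigma> t) has_vector_derivative 0) (at t)" by simp
    then have "((\<lambda>s. w \<bullet> \<sigma> s) has_vector_derivative 0) (at t)"
    proof (rule has_vector_derivative_transform_within_open[where S = ?I])
      fix s assume "s \<in> ?I"
      then obtain c where "\<sigma> t - \<sigma> s = c *\<^sub>R u" using u[OF tI] by blast
      then have "w \<bullet> (\<sigma> t - \<sigma> s) = 0" using wu by simp
      then show "w \<bullet> \<sigma> t = w \<bullet> \<sigma> s" by (simp add: inner_diff_right)
    qed (use that in auto)
    ultimately show ?thesis by (rule vector_derivative_unique_at)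
  qed
  have 0: "0 \<in> ?I" using s by simp
  have acc: "w \<bullet> (\<chi> i. - 2 * G i x y) = 0" if "w \<bullet> u = 0" for w
  proof -
    have "((\<lambda>s. w \<bullet> \<sigma>' s) has_vector_derivative w \<bullet> (\<chi> i. - 2 * G i x y)) (at 0)"
      using d[OF 0] s by (intro bounded_linear.has_vector_derivative[OF bounded_linear_inner_right]) auto
    moreover have "((\<lambda>s. 0) has_vector_derivative (0::real)) (at 0)" by simp
    then have "((\<lambda>s. w \<bullet> \<sigma>' s) has_vector_derivative 0) (at 0)"
      by (rule has_vector_derivative_transform_within_open[where S = ?I]) (use vel[OF that] 0 in auto)
    ultimately show ?thesis by (rule vector_derivative_unique_at)
  qed
  have "w \<bullet> y = 0" if "w \<bullet> u = 0" for w using vel[OF that 0] s(3) by simp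
  then obtain a where a: "y = a *\<^sub>R u" by (rule scaleR_if_orthogonal)
  obtain b where b: "(\<chi> i. - 2 * G i x y) = b *\<^sub>R u" using acc by (rule scaleR_if_orthogonal)
  have "a \<noteq> 0" using a y by auto
  then have "(\<chi> i. - 2 * G i x y) = (b / a) *\<^sub>R y" using a b by simp
  then have "- 2 * G j x y = (b / a) * y $ j" for j by (simp add: vec_eq_iff)
  then have g: "G j x y = (- (b / a) / 2) * y $ j" for j
    using arg_cong[of "- 2 * G j x y" _ "\<lambda>r. - r / 2"] by fastforce
  show ?thesis using parallel_factor[OF x y g] g by simp
qed

text \<open>For fixed w the scalar w . \<sigma>' solves a linear homogeneous equation, so it
  vanishes throughout once it vanishes at \<open>t0\<close>. Hence the curve has no component normal
  to its velocity at \<open>t0\<close>.\<close>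

lemma parallel_imp_projectively_flat:
  assumes par: "\<And>x y i. x \<in> \<Omega> \<Longrightarrow> y \<noteq> 0 \<Longrightarrow> G i x y = P x y * y $ i"
  shows "projectively_flat \<Omega> F"
  unfolding projectively_flat_def
proof (intro allI impI)
  fix a b \<sigma> assume "finsler_geodesic \<Omega> F a b \<sigma>"
  then obtain \<sigma>' where d: "\<And>t. t \<in> {a<..<b} \<Longrightarrow> \<sigma> t \<in> \<Omega> \<and> \<sigma>' t \<noteq> 0 \<and> (\<sigma> has_vector_derivative \<sigma>' t) (at t) \<and>
        (\<sigma>' has_vector_derivative (\<chi> i. - 2 * G i (\<sigma> t) (\<sigma>' t))) (at t)"
    unfolding finsler_geodesic_def by blast
  have d2: "(\<sigma>' has_vector_derivative (- 2 * P (\<sigma> t) (\<sigma>' t)) *\<^sub>R \<sigma>' t) (at t)" if "t \<in> {a<..<b}" for t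
  proof -
    have "(\<chi> i. - 2 * G i (\<sigma> t) (\<sigma>' t)) = (- 2 * P (\<sigma> t) (\<sigma>' t)) *\<^sub>R \<sigma>' t"
      using d[OF that] par by (simp add: vec_eq_iff)
    then show ?thesis using d[OF that] by simp
  qed
  have contP: "continuous_on {a<..<b} (\<lambda>t. - 2 * P (\<sigma> t) (\<sigma>' t))"
  proof (intro continuous_intros smooth2_continuous_on[OF smooth_P])
    show "continuous_on {a<..<b} \<sigma>" "continuous_on {a<..<b} \<sigma>'"
      by (intro continuous_at_imp_continuous_on ballI, meson d has_vector_derivative_continuous)+
  qed (use d in auto)
  show "collinear (\<sigma> ` {a<..<b})"
  proof (cases "a < b")
    case True
    define t0 where "t0 = (a + b) / 2"
    have t0: "t0 \<in> {a<..<b}" using True by (simp add: t0_def)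
    have 1: "w \<bullet> \<sigma>' t = 0" if w: "w \<bullet> \<sigma>' t0 = 0" and t: "t \<in> {a<..<b}" for w t
    proof -
      let ?J = "{min t0 t..max t0 t}"
      have J: "?J \<subseteq> {a<..<b}" using t t0 by auto
      have "((\<lambda>s. w \<bullet> \<sigma>' s) has_real_derivative (- 2 * P (\<sigma> s) (\<sigma>' s)) * (w \<bullet> \<sigma>' s)) (at s within ?J)"
        if "s \<in> ?J" for s
      proof -
        have "((\<lambda>s. w \<bullet> \<sigma>' s) has_vector_derivative w \<bullet> ((- 2 * P (\<sigma> s) (\<sigma>' s)) *\<^sub>R \<sigma>' s)) (at s)"
          using d2 that J by (intro bounded_linear.has_vector_derivative[OF bounded_linear_inner_right]) auto
        then show ?thesis
          by (simp add: has_real_derivative_iff_has_vector_derivative has_vector_derivative_at_within)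
      qed
      from linear_ode_zero[OF continuous_on_subset[OF contP J] this, of t0 t] w show ?thesis by auto
    qed
    have 2: "w \<bullet> \<sigma> t = w \<bullet> \<sigma> s" if w: "w \<bullet> \<sigma>' t0 = 0" and st: "s \<in> {a<..<b}" "t \<in> {a<..<b}" for w s t
    proof -
      have "((\<lambda>s. w \<bullet> \<sigma> s) has_real_derivative 0) (at s within {a<..<b})" if "s \<in> {a<..<b}" for s
      proof -
        have "((\<lambda>s. w \<bullet> \<sigma> s) has_vector_derivative w \<bullet> \<sigma>' s) (at s)"
          using d[OF that] by (intro bounded_linear.has_vector_derivative[OF bounded_linear_inner_right]) auto
        then show ?thesis using 1[OF w that]
          by (simp add: has_real_derivative_iff_has_vector_derivative has_vector_derivative_at_within)
      qed
      from has_field_derivative_zero_constant[OF _ this] show ?thesis using st by fastforce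
    qed
    show ?thesis unfolding collinear_def
    proof (intro exI[of _ "\<sigma>' t0"] ballI)
      fix p q assume "p \<in> \<sigma> ` {a<..<b}" "q \<in> \<sigma> ` {a<..<b}"
      then obtain s t where st: "s \<in> {a<..<b}" "t \<in> {a<..<b}" "p = \<sigma> t" "q = \<sigma> s" by blast
      have "w \<bullet> (p - q) = 0" if "w \<bullet> \<sigma>' t0 = 0" for w
        using 2[OF that st(1,2)] by (simp add: st(3,4) inner_diff_right)
      then obtain c where "p - q = c *\<^sub>R \<sigma>' t0" by (rule scaleR_if_orthogonal)
      then show "\<exists>c. p - q = c *\<^sub>R \<sigma>' t0" ..
    qed
  qed simp
qed

end

section \<open>Curvature\<close>

lemma inner_matrix_vector: "u \<bullet> (A *v v) = (\<Sum>i\<in>UNIV. \<Sum>j\<in>UNIV. A $ i $ j * u $ i * v $ j)"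
  for A :: "real ^ 'n ^ 'n"
  by (simp add: inner_vec_def matrix_vector_mult_def sum_distrib_left mult_ac)

lemma dim_span_pair:
  fixes y u :: "real ^ 'n"
  assumes "y \<noteq> 0" "\<And>c. u \<noteq> c *\<^sub>R y"
  shows "dim (span {y, u}) = 2"
proof -
  have "u \<notin> span {y}" using assms(2) by (auto simp: span_singleton)
  then have "independent {u, y}" using assms(1) by (simp add: independent_insert)
  moreover have "u \<noteq> y" using assms(2)[of 1] by auto
  ultimately have "dim {u, y} = 2" by (simp add: dim_eq_card_independent)
  then show ?thesis by (simp add: insert_commute)
qed

context finsler_domain
begin

definition curv_scalar :: "real ^ 'n \<Rightarrow> real ^ 'n \<Rightarrow> real" where
  "curv_scalar x y = (P x y)\<^sup>2 - grad_x P x y y"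

text \<open>The covector \<tau> of the splitting of the curvature tensor, read off by inserting G =
  P y into \<open>riemann_curv\<close>.\<close>

definition curv_covector :: "real ^ 'n \<Rightarrow> real ^ 'n \<Rightarrow> real ^ 'n" where
  "curv_covector x y = (\<chi> k. 2 * dx k P x y - P x y * dy k P x y - (\<Sum>j\<in>UNIV. y $ j * dy k (dx j P) x y))"

text \<open>Differentiating P_x y = P^2 in y^k expresses the mixed second-order term of \<tau> as 2
  P P_y - P_x. Substitution collects three copies of P_x - P P_y.\<close>

lemma curv_covector_if_scalar_zero:
  assumes s: "\<And>x y. x \<in> \<Omega> \<Longrightarrow> y \<noteq> 0 \<Longrightarrow> curv_scalar x y = 0" and x: "x \<in> \<Omega>" and y: "y \<noteq> 0"
  shows "curv_covector x y $ k = 3 * (dx k P x y - P x y * dy k P x y)"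
proof -
  have "dy k (\<lambda>x y. \<Sum>j\<in>UNIV. dx j P x y * y $ j) x y = dy k (\<lambda>x y. (P x y)\<^sup>2) x y"
    by (rule dy_cong[OF x y]) (use s in \<open>simp add: curv_scalar_def\<close>)
  also have "\<dots> = 2 * P x y * dy k P x y" by (rule dy_power2[OF x y smooth_P])
  also have "dy k (\<lambda>x y. \<Sum>j\<in>UNIV. dx j P x y * y $ j) x y
      = (\<Sum>j\<in>UNIV. dy k (dx j P) x y * y $ j) + dx k P x y"
    by (rule dy_contract[OF x y open_dom smooth2_dx[OF smooth_P]])
  finally have "(\<Sum>j\<in>UNIV. y $ j * dy k (dx j P) x y) + dx k P x y = 2 * P x y * dy k P x y"
    by (simp add: mult.commute)
  then show ?thesis by (simp add: curv_covector_def)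
qed

context
  assumes par: "\<And>x y i. x \<in> \<Omega> \<Longrightarrow> y \<noteq> 0 \<Longrightarrow> G i x y = P x y * y $ i"
begin

context
  fixes x y :: "real ^ 'n" assumes x: "x \<in> \<Omega>" and y: "y \<noteq> 0"
begin

text \<open>With G = P y inserted, Euler's relation for P and its y-derivative removes the
  contractions of y-derivatives with y. The contracted mixed derivatives of P survive inside
  \<tau>.\<close>

lemma riemann_curv_parallel:
  "riemann_curv F i k x y = (if i = k then curv_scalar x y else 0) + y $ i * curv_covector x y $ k"
proof -
  let ?\<delta> = "\<lambda>i k :: 'n. if i = k then 1 else 0 :: real"
  have dxG: "dx k (G i) x y = dx k P x y * y $ i" if "x \<in> \<Omega>" "y \<noteq> 0" for k i x y
    using that by (simp add: dx_cong[OF open_dom that par] dx_mult[OF that smooth_P smooth2_coord[OF open_dom]]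
        dx_coord[OF that open_dom])
  have dyG: "dy k (G i) x y = dy k P x y * y $ i + P x y * ?\<delta> k i" if "x \<in> \<Omega>" "y \<noteq> 0" for k i x y
    using that by (simp add: dy_cong[OF that par] dy_mult[OF that smooth_P smooth2_coord[OF open_dom]]
        dy_coord[OF that open_dom])
  have dydxG: "dy k (dx j (G i)) x y = dy k (dx j P) x y * y $ i + dx j P x y * ?\<delta> k i" for j k i
    by (simp add: dy_cong[OF x y dxG] dy_mult[OF x y smooth2_dx[OF smooth_P] smooth2_coord[OF open_dom]]
        dy_coord[OF x y open_dom])
  have dydyG: "dy k (dy j (G i)) x y = dy k (dy j P) x y * y $ i + dy j P x y * ?\<delta> k i + ?\<delta> j i * dy k P x y" for j k i
  proof -
    have "dy k (dy j (G i)) x y = dy k (\<lambda>x y. dy j P x y * y $ i + ?\<delta> j i * P x y) x y"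
      by (rule dy_cong[OF x y]) (simp add: dyG)
    also have "\<dots> = dy k (\<lambda>x y. dy j P x y * y $ i) x y + dy k (\<lambda>x y. ?\<delta> j i * P x y) x y"
      by (intro dy_add[OF x y] smooth2_intros smooth_P open_dom)
    also have "dy k (\<lambda>x y. ?\<delta> j i * P x y) x y = ?\<delta> j i * dy k P x y"
      by (rule dy_cmult[OF x y smooth_P])
    also have "dy k (\<lambda>x y. dy j P x y * y $ i) x y = dy k (dy j P) x y * y $ i + dy j P x y * ?\<delta> k i"
      by (subst dy_mult[OF x y smooth2_dy[OF smooth_P] smooth2_coord[OF open_dom]])
        (simp add: dy_coord[OF x y open_dom])
    finally show ?thesis .
  qed
  have e1: "(\<Sum>j\<in>UNIV. y $ j * dy j P x y) = P x y"
    using euler_hom2[OF smooth_P hom_P x y] by (simp add: mult.commute)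
  text \<open>\<open>y\<^sup>j P\<^sub>j\<^sub>k = 0\<close> comes from differentiating Euler's relation for \<open>P\<close>, which avoids the symmetry
    of second derivatives.\<close>
  have e2: "(\<Sum>j\<in>UNIV. y $ j * dy k (dy j P) x y) = 0" for k
  proof -
    have "dy k P x y = dy k (\<lambda>x y. \<Sum>j\<in>UNIV. dy j P x y * y $ j) x y"
      by (rule dy_cong[OF x y]) (use euler_hom2[OF smooth_P hom_P] in simp)
    also have "\<dots> = (\<Sum>j\<in>UNIV. dy k (dy j P) x y * y $ j) + dy k P x y"
      by (rule dy_contract[OF x y open_dom smooth2_dy[OF smooth_P]])
    finally show ?thesis by (simp add: mult.commute)
  qed
  have "(\<Sum>j\<in>UNIV. y $ j * dy k (dx j (G i)) x y)
      = y $ i * (\<Sum>j\<in>UNIV. y $ j * dy k (dx j P) x y) + ?\<delta> k i * grad_x P x y y"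
    unfolding dydxG by (simp add: algebra_simps sum.distrib sum_distrib_left)
  moreover have "(\<Sum>j\<in>UNIV. G j x y * dy k (dy j (G i)) x y) = P x y * (?\<delta> k i * P x y + y $ i * dy k P x y)"
  proof -
    have "(\<Sum>j\<in>UNIV. G j x y * dy k (dy j (G i)) x y)
        = (\<Sum>j\<in>UNIV. P x y * y $ i * (y $ j * dy k (dy j P) x y) + P x y * ?\<delta> k i * (y $ j * dy j P x y)
            + P x y * dy k P x y * (if j = i then y $ j else 0))"
      unfolding dydyG par[OF x y] by (intro sum.cong) (auto simp: algebra_simps)
    also have "\<dots> = P x y * y $ i * (\<Sum>j\<in>UNIV. y $ j * dy k (dy j P) x y)
        + P x y * ?\<delta> k i * (\<Sum>j\<in>UNIV. y $ j * dy j P x y) + P x y * dy k P x y * y $ i"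
      unfolding sum.distrib sum_distrib_left[symmetric] by simp
    finally show ?thesis by (simp add: e1 e2 algebra_simps)
  qed
  moreover have "(\<Sum>j\<in>UNIV. dy j (G i) x y * dy k (G j) x y) = 3 * P x y * dy k P x y * y $ i + (P x y)\<^sup>2 * ?\<delta> k i"
  proof -
    have "(\<Sum>j\<in>UNIV. dy j (G i) x y * dy k (G j) x y)
        = (\<Sum>j\<in>UNIV. y $ i * dy k P x y * (y $ j * dy j P x y) + y $ i * P x y * (if j = k then dy j P x y else 0)
            + P x y * dy k P x y * (if j = i then y $ j else 0) + (P x y)\<^sup>2 * ?\<delta> k i * (if j = i then 1 else 0))"
      unfolding dyG[OF x y] by (intro sum.cong) (auto simp: algebra_simps power2_eq_square)
    also have "\<dots> = y $ i * dy k P x y * (\<Sum>j\<in>UNIV. y $ j * dy j P x y) + y $ i * P x y * dy k P x y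
            + P x y * dy k P x y * y $ i + (P x y)\<^sup>2 * ?\<delta> k i"
      unfolding sum.distrib sum_distrib_left[symmetric] by simp
    finally show ?thesis by (simp add: e1 algebra_simps)
  qed
  ultimately show ?thesis
    unfolding riemann_curv_def
    by (simp add: dxG[OF x y] curv_scalar_def curv_covector_def algebra_simps power2_eq_square)
qed

lemma flag_curv_parallel:
  "flag_curv F x y u =
    (curv_scalar x y * (u \<bullet> (fund_tensor F x y *v u))
      + (curv_covector x y \<bullet> u) * (y \<bullet> (fund_tensor F x y *v u))) /
    ((F x y)\<^sup>2 * (u \<bullet> (fund_tensor F x y *v u)) - (y \<bullet> (fund_tensor F x y *v u))\<^sup>2)"
proof -
  let ?g = "fund_tensor F x y" and ?\<tau> = "curv_covector x y" and ?s = "curv_scalar x y"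
  have "(\<Sum>k\<in>UNIV. ?g $ i $ m * riemann_curv F i k x y * u $ k * u $ m)
      = ?s * (?g $ i $ m * u $ i * u $ m) + (?\<tau> \<bullet> u) * (?g $ i $ m * y $ i * u $ m)" for i m
  proof -
    have "(\<Sum>k\<in>UNIV. ?g $ i $ m * riemann_curv F i k x y * u $ k * u $ m)
      = (\<Sum>k\<in>UNIV. ?s * ?g $ i $ m * u $ m * (if k = i then u $ k else 0)
          + ?g $ i $ m * y $ i * u $ m * (?\<tau> $ k * u $ k))"
      by (intro sum.cong) (auto simp: riemann_curv_parallel algebra_simps)
    then show ?thesis
      unfolding sum.distrib sum_distrib_left[symmetric] by (simp add: inner_vec_def mult_ac)
  qed
  then have "(\<Sum>i\<in>UNIV. \<Sum>m\<in>UNIV. \<Sum>k\<in>UNIV. ?g $ i $ m * riemann_curv F i k x y * u $ k * u $ m)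
      = ?s * (u \<bullet> (?g *v u)) + (?\<tau> \<bullet> u) * (y \<bullet> (?g *v u))"
    by (simp add: inner_matrix_vector sum.distrib flip: sum_distrib_left)
  then show ?thesis
    unfolding flag_curv_def inner_matrix_vector by simp
qed

end

text \<open>Flags whose edge is \<open>g\<close>-orthogonal to the pole isolate \<open>P\<^sup>2 - P\<^sub>x y\<close>; tilting the edge slightly
  towards the pole then isolates the covector.\<close>

lemma zero_flag_curvature_imp:
  assumes n: "CARD('n) \<ge> 2" and zero: "zero_flag_curvature \<Omega> F" and x: "x \<in> \<Omega>" and y: "y \<noteq> 0"
  shows "curv_scalar x y = 0" and "curv_covector x y = 0"
proof -
  let ?g = "fund_tensor F x y" and ?\<tau> = "curv_covector x y" and ?s = "curv_scalar x y"
  define l where "l = (\<lambda>v. y \<bullet> (?g *v v))"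
  have l_add: "l (a + b) = l a + l b" and l_scale: "l (c *\<^sub>R a) = c * l a" for a b c
    by (simp_all add: l_def matrix_vector_right_distrib matrix_vector_mult_scaleR inner_add_right)
  have ly: "l y > 0" using fund_pos[OF x y y] by (simp add: l_def)
  have indep: "dim (span {y, v + s *\<^sub>R y}) = 2" if "l v = 0" "v \<noteq> 0" for v s
  proof (rule dim_span_pair[OF y])
    fix c show "v + s *\<^sub>R y \<noteq> c *\<^sub>R y"
    proof
      assume "v + s *\<^sub>R y = c *\<^sub>R y"
      then have v: "v = (c - s) *\<^sub>R y" by (simp add: algebra_simps)
      with that have "(c - s) * l y = 0" by (metis l_scale)
      with v ly that(2) show False by simp
    qed
  qed
  \<comment> \<open>A quotient with denominator 0 counts as 0 and would carry no information, so
    positivity of the denominator is demanded here. It is clear for an edge in the kernel of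
    \<open>l\<close> and persists for small tilts by continuity.\<close>
  have num: "?s * (u \<bullet> (?g *v u)) + (?\<tau> \<bullet> u) * l u = 0"
    if "dim (span {y, u}) = 2" "(F x y)\<^sup>2 * (u \<bullet> (?g *v u)) - (l u)\<^sup>2 > 0" for u
    using that zero x flag_curv_parallel[OF x y, of u] unfolding zero_flag_curvature_def l_def by auto
  have Fv: "(F x y)\<^sup>2 * (v \<bullet> (?g *v v)) > 0" if "v \<noteq> 0" for v
    using F_pos[OF x y] fund_pos[OF x y that] by simp
  obtain v0 where v0: "v0 \<noteq> 0" "l v0 = 0"
  proof -
    \<comment> \<open>The transpose moves g onto y, so \<open>l\<close> is an ordinary inner product
      with a fixed vector; dimension at least 2 gives a nonzero vector orthogonal to it.\<close>
    obtain v where v: "v \<noteq> 0" "orthogonal (transpose ?g *v y) v"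
      using orthogonal_to_vector_exists[of "transpose ?g *v y"] n by auto
    then show thesis
      by (intro that[of v]) (simp_all add: l_def orthogonal_def dot_lmul_matrix flip: vector_transpose_matrix)
  qed
  have "?s * (v0 \<bullet> (?g *v v0)) = 0" using num[of v0] indep[OF v0(2,1), of 0] Fv[OF v0(1)] v0(2) by simp
  then show s0: "?s = 0" using fund_pos[OF x y v0(1)] by simp
  have tau: "?\<tau> \<bullet> v = 0 \<and> ?\<tau> \<bullet> y = 0" if v: "v \<noteq> 0" "l v = 0" for v
  proof -
    define d where "d = (\<lambda>s. (F x y)\<^sup>2 * ((v + s *\<^sub>R y) \<bullet> (?g *v (v + s *\<^sub>R y))) - (l (v + s *\<^sub>R y))\<^sup>2)"
    have "isCont d 0"
      unfolding d_def l_add l_scale matrix_vector_right_distrib matrix_vector_mult_scaleR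
      by (intro continuous_intros)
    moreover have "d 0 > 0" using Fv[OF v(1)] v(2) by (simp add: d_def)
    ultimately have "\<forall>\<^sub>F s in at 0. d s > 0" unfolding isCont_def by (rule order_tendstoD)
    then obtain \<delta> where \<delta>: "\<delta> > 0" "\<And>s. s \<noteq> 0 \<Longrightarrow> \<bar>s\<bar> < \<delta> \<Longrightarrow> d s > 0"
      by (auto simp: eventually_at)
    \<comment> \<open>As the scalar part is 0, the numerator is this expression times s l(y), a
      nonzero factor. Two values of s then separate its two terms.\<close>
    have *: "?\<tau> \<bullet> v + s * (?\<tau> \<bullet> y) = 0" if "s \<noteq> 0" "\<bar>s\<bar> < \<delta>" for s
      using num[OF indep[OF v(2,1)], of s] \<delta>(2)[OF that] s0 ly that(1) v(2)
      by (simp add: d_def l_add l_scale inner_add_right)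
    have "?\<tau> \<bullet> v + \<delta>/2 * (?\<tau> \<bullet> y) = 0" "?\<tau> \<bullet> v + \<delta>/3 * (?\<tau> \<bullet> y) = 0"
      using *[of "\<delta>/2"] *[of "\<delta>/3"] \<delta>(1) by auto
    moreover from this have "\<delta> * (?\<tau> \<bullet> y) = 0" by argo
    ultimately show ?thesis using \<delta>(1) by auto
  qed
  have ty: "?\<tau> \<bullet> y = 0" using tau[OF v0] by blast
  have "?\<tau> \<bullet> u = 0" for u
  proof -
    define v where "v = u - (l u / l y) *\<^sub>R y"
    have u: "u = v + (l u / l y) *\<^sub>R y" by (simp add: v_def)
    have "l u = l v + (l u / l y) * l y" by (metis u l_add l_scale)
    then have "l v = 0" using ly by simp
    then have "?\<tau> \<bullet> v = 0" using tau[of v] by (cases "v = 0") auto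
    then show ?thesis by (subst u) (simp add: inner_add_right ty)
  qed
  then show "?\<tau> = 0" by (metis inner_eq_zero_iff)
qed

lemma zero_flag_curvature_imp_transport:
  assumes n: "CARD('n) \<ge> 2" and zero: "zero_flag_curvature \<Omega> F" and x: "x \<in> \<Omega>" and y: "y \<noteq> 0"
  shows "dx k P x y = P x y * dy k P x y"
  using curv_covector_if_scalar_zero[OF zero_flag_curvature_imp(1)[OF n zero] x y, of k]
    zero_flag_curvature_imp(2)[OF n zero x y] by simp

text \<open>Contracting P_x = P P_y with y and using Euler gives P_x y = P^2, so the scalar part
  vanishes; then \<tau> is 3 (P_x - P P_y) and vanishes too.\<close>

lemma transport_imp_zero_flag_curvature:
  assumes tr: "\<And>x y k. x \<in> \<Omega> \<Longrightarrow> y \<noteq> 0 \<Longrightarrow> dx k P x y = P x y * dy k P x y"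
  shows "zero_flag_curvature \<Omega> F"
proof -
  have Q: "grad_x P x y y = (P x y)\<^sup>2" if "x \<in> \<Omega>" "y \<noteq> 0" for x y
  proof -
    have "grad_x P x y y = P x y * grad_y P x y y"
      by (simp add: tr[OF that] sum_distrib_left mult_ac)
    then show ?thesis using euler_hom2[OF smooth_P hom_P that] by (simp add: power2_eq_square)
  qed
  have s: "curv_scalar x y = 0" if "x \<in> \<Omega>" "y \<noteq> 0" for x y
    using Q[OF that] by (simp add: curv_scalar_def)
  have t: "curv_covector x y = 0" if "x \<in> \<Omega>" "y \<noteq> 0" for x y
    using curv_covector_if_scalar_zero[OF s that] tr[OF that] by (simp add: vec_eq_iff)
  have "y \<noteq> 0" if "dim (span {y, u}) = 2" for y u :: "real ^ 'n"
  proof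
    assume "y = 0"
    with that have "dim {u} = 2" by simp
    moreover have "dim {u} \<le> card {u}" by (rule dim_le_card') simp
    ultimately show False by simp
  qed
  then show ?thesis
    unfolding zero_flag_curvature_def by (auto simp: flag_curv_parallel s t)
qed

end

end

section \<open>The explicit metrics\<close>

lemma norm_line_derivative:
  fixes y v :: "'a::real_inner"
  assumes "y \<noteq> 0"
  shows "((\<lambda>s. norm (y + s *\<^sub>R v)) has_real_derivative (y \<bullet> v) / norm y) (at 0)"
proof -
  have eq: "norm (y + s *\<^sub>R v) = sqrt (y \<bullet> y + 2 * s * (y \<bullet> v) + s\<^sup>2 * (v \<bullet> v))" for s
    by (simp add: norm_eq_sqrt_inner inner_simps inner_commute power2_eq_square algebra_simps)
  have "y \<bullet> y > 0" using assms by simp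
  then show ?thesis
    unfolding eq by (auto intro!: derivative_eq_intros simp: norm_eq_sqrt_inner field_simps leD[OF inner_ge_zero])
qed

text \<open>One sign suffices: the other one is \<open>berwald (- c)\<close>, and c = 0 gives the
  Euclidean norm, so this single family covers every case of the theorem.\<close>

definition berwald :: "real \<Rightarrow> real ^ 'n \<Rightarrow> real ^ 'n \<Rightarrow> real" where
  "berwald c x y = (norm y) ^ 4 / (z_fun c x y * (c * (x \<bullet> y) - z_fun c x y)\<^sup>2)"

text \<open>The root \<open>N\<close> of \<open>N = |y + c N x|\<close>.\<close>

definition berwald_root :: "real \<Rightarrow> real ^ 'n \<Rightarrow> real ^ 'n \<Rightarrow> real" where
  "berwald_root c x y = (c * (x \<bullet> y) + z_fun c x y) / (1 - c\<^sup>2 * (x \<bullet> x))"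

lemma z_fun_inner: "z_fun c x y = sqrt ((1 - c\<^sup>2 * (x \<bullet> x)) * (y \<bullet> y) + c\<^sup>2 * (x \<bullet> y)\<^sup>2)"
  by (simp add: z_fun_def power2_norm_eq_inner)

context
  fixes c :: real and x y :: "real ^ 'n"
  assumes x: "c\<^sup>2 * (x \<bullet> x) < 1" and y: "y \<noteq> 0"
begin

text \<open>The radicand exceeds c^2 <x, y>^2 by (1 - c^2 |x|^2) |y|^2. This makes the denominators
  of \<open>berwald\<close> nonzero and the root N positive.\<close>

lemma z_fun_pos: "z_fun c x y > \<bar>c * (x \<bullet> y)\<bar>"
proof -
  have "(1 - c\<^sup>2 * (x \<bullet> x)) * (y \<bullet> y) > 0" using x y by simp
  then have "sqrt ((c * (x \<bullet> y))\<^sup>2) < z_fun c x y"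
    unfolding z_fun_inner by (intro real_sqrt_less_mono) (simp add: power_mult_distrib)
  then show ?thesis by simp
qed

lemma z_fun_sq: "(z_fun c x y)\<^sup>2 = (1 - c\<^sup>2 * (x \<bullet> x)) * (y \<bullet> y) + c\<^sup>2 * (x \<bullet> y)\<^sup>2"
proof -
  have "(1 - c\<^sup>2 * (x \<bullet> x)) * (y \<bullet> y) > 0" using x y by simp
  then show ?thesis unfolding z_fun_inner by (simp add: add_nonneg_nonneg less_imp_le)
qed

text \<open>Eliminates the square root: with this and \<open>berwald_root_quadratic\<close>, the
  identities needed below become polynomial in N and inner products.\<close>

lemma berwald_root_z: "z_fun c x y = (1 - c\<^sup>2 * (x \<bullet> x)) * berwald_root c x y - c * (x \<bullet> y)"
  using x by (simp add: berwald_root_def)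

lemma berwald_root_pos: "berwald_root c x y > 0"
  using z_fun_pos x unfolding berwald_root_def by (intro divide_pos_pos) auto

lemma berwald_root_quadratic:
  "y \<bullet> y = (1 - c\<^sup>2 * (x \<bullet> x)) * (berwald_root c x y)\<^sup>2 - 2 * c * (x \<bullet> y) * berwald_root c x y"
proof -
  let ?A = "1 - c\<^sup>2 * (x \<bullet> x)" and ?N = "berwald_root c x y"
  have "?A * (y \<bullet> y) + c\<^sup>2 * (x \<bullet> y)\<^sup>2 = (?A * ?N - c * (x \<bullet> y))\<^sup>2"
    using z_fun_sq berwald_root_z by simp
  then have "?A * (y \<bullet> y) = ?A * (?A * ?N\<^sup>2 - 2 * c * (x \<bullet> y) * ?N)"
    by (simp only: power2_eq_square) (simp add: algebra_simps)
  then show ?thesis using x by simp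
qed

text \<open>The quadratic for N factors as |y|^2 = N (z - c <x, y>); squaring it cancels the squared
  bracket in the denominator.\<close>

lemma berwald_eq: "berwald c x y = (berwald_root c x y)\<^sup>2 / z_fun c x y"
proof -
  let ?A = "1 - c\<^sup>2 * (x \<bullet> x)" and ?N = "berwald_root c x y" and ?B = "c * (x \<bullet> y)"
  have "y \<bullet> y = ?N * (z_fun c x y - ?B)"
    unfolding berwald_root_z by (subst berwald_root_quadratic) (simp add: algebra_simps power2_eq_square)
  then have "(norm y) ^ 4 = (?N * (z_fun c x y - ?B))\<^sup>2"
    by (simp add: power4_eq_xxxx dot_square_norm power2_eq_square flip: mult.assoc)
  also have "\<dots> = ?N\<^sup>2 * (?B - z_fun c x y)\<^sup>2" by (simp add: power_mult_distrib power2_commute)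
  finally show ?thesis using z_fun_pos by (simp add: berwald_def)
qed

lemma berwald_root_norm: "norm (y + (c * berwald_root c x y) *\<^sub>R x) = berwald_root c x y"
proof -
  have "(norm (y + (c * berwald_root c x y) *\<^sub>R x))\<^sup>2 = (berwald_root c x y)\<^sup>2"
    unfolding power2_norm_eq_inner using berwald_root_quadratic
    by (simp add: inner_simps inner_commute algebra_simps power2_eq_square)
  then show ?thesis using berwald_root_pos by (simp add: power2_eq_iff_nonneg)
qed

lemma z_fun_line_x:
  "((\<lambda>t. z_fun c (x + t *\<^sub>R v) y) has_real_derivative
     c\<^sup>2 * ((x \<bullet> y) * (y \<bullet> v) - (x \<bullet> v) * (y \<bullet> y)) / z_fun c x y) (at 0)"
proof -
  have eq: "z_fun c (x + t *\<^sub>R v) y = sqrt ((1 - c\<^sup>2 * ((x \<bullet> x) + 2 * t * (x \<bullet> v) + t\<^sup>2 * (v \<bullet> v))) * (y \<bullet> y)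
      + c\<^sup>2 * (x \<bullet> y + t * (y \<bullet> v))\<^sup>2)" for t
    by (simp add: z_fun_inner inner_simps inner_commute power2_eq_square algebra_simps)
  have "(1 - c\<^sup>2 * (x \<bullet> x)) * (y \<bullet> y) + c\<^sup>2 * (x \<bullet> y)\<^sup>2 > 0"
    using z_fun_sq z_fun_pos by (metis abs_ge_zero order_le_less_trans zero_less_power)
  then show ?thesis
    unfolding eq z_fun_inner[of c x y]
    by (auto intro!: derivative_eq_intros simp: field_simps)
qed

lemma z_fun_line_y:
  "((\<lambda>t. z_fun c x (y + t *\<^sub>R v)) has_real_derivative
     ((1 - c\<^sup>2 * (x \<bullet> x)) * (y \<bullet> v) + c\<^sup>2 * (x \<bullet> y) * (x \<bullet> v)) / z_fun c x y) (at 0)"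
proof -
  have eq: "z_fun c x (y + t *\<^sub>R v) = sqrt ((1 - c\<^sup>2 * (x \<bullet> x)) * ((y \<bullet> y) + 2 * t * (y \<bullet> v) + t\<^sup>2 * (v \<bullet> v))
      + c\<^sup>2 * (x \<bullet> y + t * (x \<bullet> v))\<^sup>2)" for t
    by (simp add: z_fun_inner inner_simps inner_commute power2_eq_square algebra_simps)
  have "(1 - c\<^sup>2 * (x \<bullet> x)) * (y \<bullet> y) + c\<^sup>2 * (x \<bullet> y)\<^sup>2 > 0"
    using z_fun_sq z_fun_pos by (metis abs_ge_zero order_le_less_trans zero_less_power)
  then show ?thesis
    unfolding eq z_fun_inner[of c x y]
    by (auto intro!: derivative_eq_intros simp: field_simps)
qed

text \<open>The value agrees with implicit differentiation of N^2 = |y + c N x|^2, where the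
  coefficient of the unknown derivative is N - c <x, y + c N x> = z.\<close>

lemma berwald_root_line_y:
  "((\<lambda>t. berwald_root c x (y + t *\<^sub>R v)) has_real_derivative
     (c * berwald_root c x y * (x \<bullet> v) + y \<bullet> v) / z_fun c x y) (at 0)"
proof -
  let ?A = "1 - c\<^sup>2 * (x \<bullet> x)" and ?N = "berwald_root c x y" and ?z = "z_fun c x y"
  let ?zy = "(?A * (y \<bullet> v) + c\<^sup>2 * (x \<bullet> y) * (x \<bullet> v)) / ?z"
  have A: "?A > 0" and z: "?z > 0" using x z_fun_pos by auto
  have eq: "berwald_root c x (y + t *\<^sub>R v) = (c * (x \<bullet> y + t * (x \<bullet> v)) + z_fun c x (y + t *\<^sub>R v)) / ?A" for t
    by (simp add: berwald_root_def inner_simps)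
  have "((\<lambda>t. berwald_root c x (y + t *\<^sub>R v)) has_real_derivative (c * (x \<bullet> v) + ?zy) / ?A) (at 0)"
    unfolding eq by (rule derivative_eq_intros z_fun_line_y refl)+ (use A in auto)
  also have "(c * (x \<bullet> v) + ?zy) / ?A = (c * ?N * (x \<bullet> v) + y \<bullet> v) / ?z"
  proof -
    have "c * (x \<bullet> v) * ?z + (?A * (y \<bullet> v) + c\<^sup>2 * (x \<bullet> y) * (x \<bullet> v)) = (c * ?N * (x \<bullet> v) + y \<bullet> v) * ?A"
      unfolding berwald_root_z by (simp add: algebra_simps power2_eq_square)
    then have "c * (x \<bullet> v) + ?zy = (c * ?N * (x \<bullet> v) + y \<bullet> v) * ?A / ?z"
      using z by (simp add: field_simps)
    then show ?thesis using A by simp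
  qed
  finally show ?thesis .
qed

text \<open>This is c N times the y-derivative in the same direction, so c N already solves the
  transport equation.\<close>

lemma berwald_root_line_x:
  "((\<lambda>t. berwald_root c (x + t *\<^sub>R v) y) has_real_derivative
     c * berwald_root c x y * (c * berwald_root c x y * (x \<bullet> v) + y \<bullet> v) / z_fun c x y) (at 0)"
proof -
  let ?A = "1 - c\<^sup>2 * (x \<bullet> x)" and ?N = "berwald_root c x y" and ?z = "z_fun c x y"
  let ?zx = "c\<^sup>2 * ((x \<bullet> y) * (y \<bullet> v) - (x \<bullet> v) * (y \<bullet> y)) / ?z"
  have A: "?A > 0" and z: "?z > 0" using x z_fun_pos by auto
  have eq: "berwald_root c (x + t *\<^sub>R v) y = (c * (x \<bullet> y + t * (y \<bullet> v)) + z_fun c (x + t *\<^sub>R v) y)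
      / (1 - c\<^sup>2 * ((x \<bullet> x) + 2 * t * (x \<bullet> v) + t\<^sup>2 * (v \<bullet> v)))" for t
    by (simp add: berwald_root_def inner_simps inner_commute power2_eq_square algebra_simps)
  have "((\<lambda>t. berwald_root c (x + t *\<^sub>R v) y) has_real_derivative
      ((c * (y \<bullet> v) + ?zx) * ?A + (c * (x \<bullet> y) + ?z) * (c\<^sup>2 * (2 * (x \<bullet> v)))) / (?A * ?A)) (at 0)"
    unfolding eq by (rule derivative_eq_intros z_fun_line_x refl)+ (use A in auto)
  also have "c * (x \<bullet> y) + ?z = ?A * ?N" unfolding berwald_root_z by simp
  also have "((c * (y \<bullet> v) + ?zx) * ?A + ?A * ?N * (c\<^sup>2 * (2 * (x \<bullet> v)))) / (?A * ?A)
      = (c * (y \<bullet> v) + ?zx + ?N * (c\<^sup>2 * (2 * (x \<bullet> v)))) / ?A"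
    using A by (simp add: divide_simps) (simp add: algebra_simps)
  also have "\<dots> = c * ?N * (c * ?N * (x \<bullet> v) + y \<bullet> v) / ?z"
  proof -
    have "c * (y \<bullet> v) * ?z + c\<^sup>2 * ((x \<bullet> y) * (y \<bullet> v) - (x \<bullet> v) * (y \<bullet> y)) + ?N * (c\<^sup>2 * (2 * (x \<bullet> v))) * ?z
        = c * ?N * (c * ?N * (x \<bullet> v) + y \<bullet> v) * ?A"
      unfolding berwald_root_z by (subst berwald_root_quadratic) (simp add: algebra_simps power2_eq_square)
    then have "c * (y \<bullet> v) + ?zx + ?N * (c\<^sup>2 * (2 * (x \<bullet> v))) = c * ?N * (c * ?N * (x \<bullet> v) + y \<bullet> v) * ?A / ?z"
      using z by (simp add: field_simps)
    then show ?thesis using A by simp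
  qed
  finally show ?thesis .
qed

end

section \<open>Flatness of the explicit metrics\<close>

context finsler_domain
begin

lemma open_line:
  assumes "x \<in> \<Omega>"
  shows "open ((\<lambda>t::real. x + t *\<^sub>R v) -` \<Omega>)" "0 \<in> (\<lambda>t::real. x + t *\<^sub>R v) -` \<Omega>"
  using assms by (auto intro!: open_vimage[OF open_dom] continuous_intros)

lemma open_line_slit:
  fixes y v :: "real ^ 'n"
  assumes "y \<noteq> 0"
  shows "open ((\<lambda>t::real. y + t *\<^sub>R v) -` (UNIV - {0}))" "0 \<in> (\<lambda>t::real. y + t *\<^sub>R v) -` (UNIV - {0})"
  using assms by (auto intro!: open_vimage open_Diff continuous_intros)

context
  fixes a c :: real
  assumes formula: "\<And>x y. x \<in> \<Omega> \<Longrightarrow> y \<noteq> 0 \<Longrightarrow> F x y = a * berwald c x y"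
    and small: "\<And>x. x \<in> \<Omega> \<Longrightarrow> c\<^sup>2 * (x \<bullet> x) < 1"
begin

context
  fixes x y :: "real ^ 'n" assumes x: "x \<in> \<Omega>" and y: "y \<noteq> 0"
begin

lemma berwald_F: "F x y = a * ((berwald_root c x y)\<^sup>2 / z_fun c x y)"
  using formula[OF x y] berwald_eq[OF small[OF x] y] by simp

text \<open>Hamel's condition with c N in the place of P and the y-derivative of c N written out. It
  comes before P is known; contraction with y then identifies P.\<close>

lemma berwald_hamel:
  "dx k F x y = c * ((c * berwald_root c x y * x $ k + y $ k) / z_fun c x y) * F x y + c * berwald_root c x y * dy k F x y"
proof -
  note s = small[OF x]
  let ?v = "axis k 1 :: real ^ 'n"
  let ?N = "berwald_root c x y" and ?z = "z_fun c x y" and ?A = "1 - c\<^sup>2 * (x \<bullet> x)"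
  let ?n = "c * ?N * (x \<bullet> ?v) + y \<bullet> ?v"
  let ?zx = "c\<^sup>2 * ((x \<bullet> y) * (y \<bullet> ?v) - (x \<bullet> ?v) * (y \<bullet> y)) / ?z"
  let ?zy = "(?A * (y \<bullet> ?v) + c\<^sup>2 * (x \<bullet> y) * (x \<bullet> ?v)) / ?z"
  have z: "?z > 0" using z_fun_pos[OF s y] by auto
  have "((\<lambda>t. a * ((berwald_root c (x + t *\<^sub>R ?v) y)\<^sup>2 / z_fun c (x + t *\<^sub>R ?v) y)) has_real_derivative
      a * ((2 * ?N * (c * ?N * ?n / ?z) * ?z - ?N\<^sup>2 * ?zx) / (?z * ?z))) (at 0)"
    by (rule derivative_eq_intros z_fun_line_x[OF s y] berwald_root_line_x[OF s y] refl)+ (use z in auto)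
  then have "((\<lambda>t. F (x + t *\<^sub>R ?v) y) has_real_derivative
      a * ((2 * ?N * (c * ?N * ?n / ?z) * ?z - ?N\<^sup>2 * ?zx) / (?z * ?z))) (at 0)"
    by (rule has_field_derivative_transform_within_open[OF _ open_line[OF x, of ?v]])
      (use y in \<open>auto simp: formula berwald_eq[OF small]\<close>)
  then have Fx: "dx k F x y = a * ((2 * ?N * (c * ?N * ?n / ?z) * ?z - ?N\<^sup>2 * ?zx) / (?z * ?z))"
    by (rule dx_unique[OF x y smooth_F])
  have "((\<lambda>t. a * ((berwald_root c x (y + t *\<^sub>R ?v))\<^sup>2 / z_fun c x (y + t *\<^sub>R ?v))) has_real_derivative
      a * ((2 * ?N * (?n / ?z) * ?z - ?N\<^sup>2 * ?zy) / (?z * ?z))) (at 0)"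
    by (rule derivative_eq_intros z_fun_line_y[OF s y] berwald_root_line_y[OF s y] refl)+ (use z in auto)
  then have "((\<lambda>t. F x (y + t *\<^sub>R ?v)) has_real_derivative
      a * ((2 * ?N * (?n / ?z) * ?z - ?N\<^sup>2 * ?zy) / (?z * ?z))) (at 0)"
    by (rule has_field_derivative_transform_within_open[OF _ open_line_slit[OF y, of ?v]])
      (use x in \<open>auto simp: formula berwald_eq[OF small]\<close>)
  then have Fy: "dy k F x y = a * ((2 * ?N * (?n / ?z) * ?z - ?N\<^sup>2 * ?zy) / (?z * ?z))"
    by (rule dy_unique[OF x y smooth_F])
  \<comment> \<open>Pure field arithmetic with the derivatives of z kept abstract. What remains is
    the identity c N z_y - z_x = c n, where the quadratic for N enters.\<close>
  have alg: "a * ((2 * N * (c * N * n / z) * z - N\<^sup>2 * zx) / (z * z))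
      - (c * (n / z) * (a * (N\<^sup>2 / z)) + c * N * (a * ((2 * N * (n / z) * z - N\<^sup>2 * zy) / (z * z))))
      = a * N\<^sup>2 / (z * z) * ((c * N * zy - zx) - c * n)" if "z \<noteq> 0" for a c N n z zx zy :: real
    using that by (simp add: field_simps power2_eq_square)
  have key: "c * ?N * (?zy * ?z) - ?zx * ?z = c * ?n * ?z"
  proof -
    have "c * ?N * (?A * (y \<bullet> ?v) + c\<^sup>2 * (x \<bullet> y) * (x \<bullet> ?v)) - c\<^sup>2 * ((x \<bullet> y) * (y \<bullet> ?v) - (x \<bullet> ?v) * (y \<bullet> y))
      = c * ?n * ?z"
      unfolding berwald_root_z[OF s y]
      by (subst berwald_root_quadratic[OF s y]) (simp add: algebra_simps power2_eq_square)
    then show ?thesis using z by simp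
  qed
  have key': "c * ?N * ?zy - ?zx = c * ?n"
  proof -
    have "(c * ?N * ?zy - ?zx) * ?z = (c * ?n) * ?z" using key by (simp only: left_diff_distrib mult.assoc)
    then show ?thesis using mult_right_cancel[OF less_imp_neq[OF z, symmetric]] by blast
  qed
  have "dx k F x y - (c * (?n / ?z) * F x y + c * ?N * dy k F x y)
      = a * ?N\<^sup>2 / (?z * ?z) * ((c * ?N * ?zy - ?zx) - c * ?n)"
    unfolding Fx Fy berwald_F using z by (intro alg) simp
  then show ?thesis using key' by (simp add: inner_axis)
qed

text \<open>Contracting \<open>berwald_hamel\<close> with y gives c N F twice: once by Euler's
  relation, once because c N <x, y> + |y|^2 = N z.\<close>

lemma berwald_proj_factor: "P x y = c * berwald_root c x y"
proof -
  note s = small[OF x]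
  let ?N = "berwald_root c x y" and ?z = "z_fun c x y"
  have z: "?z > 0" using z_fun_pos[OF s y] by auto
  have "grad_x F x y y = c * F x y / ?z * (\<Sum>k\<in>UNIV. (c * ?N * x $ k + y $ k) * y $ k) + c * ?N * grad_y F x y y"
    unfolding sum_distrib_left sum.distrib[symmetric]
    by (intro sum.cong refl) (simp add: berwald_hamel algebra_simps add_divide_distrib)
  also have "grad_y F x y y = F x y" using euler_hom2[OF smooth_F hom_F x y] by simp
  also have "(\<Sum>k\<in>UNIV. (c * ?N * x $ k + y $ k) * y $ k) = c * ?N * (x \<bullet> y) + y \<bullet> y"
    by (simp add: inner_vec_def sum.distrib sum_distrib_left algebra_simps)
  also have "\<dots> = ?N * ?z"
    unfolding berwald_root_z[OF s y]
    by (subst berwald_root_quadratic[OF s y]) (simp add: algebra_simps power2_eq_square)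
  finally have "grad_x F x y y = 2 * (c * ?N) * F x y" using z by (simp add: field_simps)
  then show ?thesis using F_pos[OF x y] by (simp add: proj_factor_def)
qed

end

lemma berwald_dx_P:
  assumes x: "x \<in> \<Omega>" and y: "y \<noteq> 0"
  shows "dx k P x y = c * (c * berwald_root c x y * (c * berwald_root c x y * x $ k + y $ k) / z_fun c x y)"
proof (rule dx_unique[OF x y smooth_P])
  show "((\<lambda>t. P (x + t *\<^sub>R axis k 1) y) has_real_derivative
      c * (c * berwald_root c x y * (c * berwald_root c x y * x $ k + y $ k) / z_fun c x y)) (at 0)"
    by (rule has_field_derivative_transform_within_open
        [OF DERIV_cmult[OF berwald_root_line_x[OF small[OF x] y, of "axis k 1", unfolded inner_axis inner_real_def mult_1_right]]
          open_line[OF x, of "axis k 1"]])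
      (use berwald_proj_factor y in auto)
qed

lemma berwald_dy_P:
  assumes x: "x \<in> \<Omega>" and y: "y \<noteq> 0"
  shows "dy k P x y = c * ((c * berwald_root c x y * x $ k + y $ k) / z_fun c x y)"
proof (rule dy_unique[OF x y smooth_P])
  show "((\<lambda>t. P x (y + t *\<^sub>R axis k 1)) has_real_derivative
      c * ((c * berwald_root c x y * x $ k + y $ k) / z_fun c x y)) (at 0)"
    by (rule has_field_derivative_transform_within_open
        [OF DERIV_cmult[OF berwald_root_line_y[OF small[OF x] y, of "axis k 1", unfolded inner_axis inner_real_def mult_1_right]]
          open_line_slit[OF y, of "axis k 1"]])
      (use berwald_proj_factor[OF x] in auto)
qed

lemma berwald_flat: "projectively_flat \<Omega> F" "zero_flag_curvature \<Omega> F"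
proof -
  have par: "G i x y = P x y * y $ i" if xy: "x \<in> \<Omega>" "y \<noteq> 0" for x y i
  proof -
    have "dx l F x y = dy l P x y * F x y + P x y * dy l F x y" for l
      using berwald_hamel[OF xy, of l] berwald_dy_P[OF xy, of l] berwald_proj_factor[OF xy] by simp
    then show ?thesis using parallel_iff[OF xy] by blast
  qed
  show "projectively_flat \<Omega> F" by (rule parallel_imp_projectively_flat[OF par])
  show "zero_flag_curvature \<Omega> F"
  proof (rule transport_imp_zero_flag_curvature[OF par])
    fix x y k assume xy: "x \<in> \<Omega>" "y \<noteq> (0 :: real ^ 'n)"
    show "dx k P x y = P x y * dy k P x y"
      by (simp add: berwald_dx_P[OF xy] berwald_dy_P[OF xy] berwald_proj_factor[OF xy])
  qed auto
qed

end

end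

section \<open>Characteristics\<close>

context finsler_domain
begin

text \<open>The transport equation \<open>P\<^sub>x = P P\<^sub>y\<close> makes \<open>P\<close> constant along
  \<open>t \<mapsto> (t x, y\<^sub>0 - t P(0, y\<^sub>0) x)\<close>.\<close>

context
  fixes a b :: real
  assumes star: "\<And>x t. x \<in> \<Omega> \<Longrightarrow> 0 \<le> t \<Longrightarrow> t \<le> 1 \<Longrightarrow> t *\<^sub>R x \<in> \<Omega>"
    and hamel: "\<And>x y k. x \<in> \<Omega> \<Longrightarrow> y \<noteq> 0 \<Longrightarrow> dx k F x y = dy k P x y * F x y + P x y * dy k F x y"
    and transport: "\<And>x y k. x \<in> \<Omega> \<Longrightarrow> y \<noteq> 0 \<Longrightarrow> dx k P x y = P x y * dy k P x y"
    and F_0: "\<And>y. y \<noteq> 0 \<Longrightarrow> F 0 y = a * norm y"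
    and P_0: "\<And>y. y \<noteq> 0 \<Longrightarrow> P 0 y = b * norm y"
begin

lemma grad_hamel:
  "x \<in> \<Omega> \<Longrightarrow> y \<noteq> 0 \<Longrightarrow> grad_x F x y v = grad_y P x y v * F x y + P x y * grad_y F x y v"
  by (simp add: hamel sum_distrib_left sum_distrib_right algebra_simps sum.distrib)

lemma grad_transport:
  "x \<in> \<Omega> \<Longrightarrow> y \<noteq> 0 \<Longrightarrow> grad_x P x y v = P x y * grad_y P x y v"
  by (simp add: transport sum_distrib_left algebra_simps)

text \<open>Keeps the second component of a characteristic away from 0, where F and P need not be
  differentiable.\<close>

lemma char_nonzero:
  fixes x y0 :: "real ^ 'n"
  assumes "\<bar>b\<bar> * norm x < 1" "y0 \<noteq> 0" "0 \<le> t" "t \<le> 1"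
  shows "y0 - (t * (b * norm y0)) *\<^sub>R x \<noteq> 0"
proof
  assume "y0 - (t * (b * norm y0)) *\<^sub>R x = 0"
  then have "norm y0 = norm ((t * (b * norm y0)) *\<^sub>R x)" by simp
  also have "\<dots> = t * (norm y0 * (\<bar>b\<bar> * norm x))" using assms(3) by (simp add: abs_mult)
  also have "\<dots> \<le> 1 * (norm y0 * (\<bar>b\<bar> * norm x))" using assms(4) by (intro mult_right_mono) auto
  also have "\<dots> < norm y0" using assms(1,2) by simp
  finally show False by simp
qed

text \<open>The curve is run with the constant speed p given by the initial value of P. The
  transport equation makes the deviation h = P - p satisfy h' = (P_y x) h with h(0) = 0, so it
  vanishes.\<close>

lemma char_P:
  assumes x: "x \<in> \<Omega>" "\<bar>b\<bar> * norm x < 1" and y0: "y0 \<noteq> 0"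
  shows "P x (y0 - (b * norm y0) *\<^sub>R x) = b * norm y0"
proof -
  define p where "p = b * norm y0"
  let ?X = "\<lambda>t::real. t *\<^sub>R x" and ?Y = "\<lambda>t::real. y0 - (t * p) *\<^sub>R x"
  have slit: "?X t \<in> \<Omega> \<and> ?Y t \<noteq> 0" if "t \<in> {0..1}" for t
    using star[OF x(1)] char_nonzero[OF x(2) y0] that by (auto simp: p_def)
  have "P (?X 1) (?Y 1) - p = 0"
  proof (rule linear_ode_zero[where \<beta> = "\<lambda>t. grad_y P (?X t) (?Y t) x" and c = 0 and d = 1
        and h = "\<lambda>t. P (?X t) (?Y t) - p"])
    show "continuous_on {0..1} (\<lambda>t. grad_y P (?X t) (?Y t) x)"
      by (intro continuous_intros smooth2_continuous_on[OF smooth2_dy[OF smooth_P]] slit)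
    show "P (?X 0) (?Y 0) - p = 0" using P_0[OF y0] by (simp add: p_def)
    fix t :: real assume t: "t \<in> {0..1}"
    have "(?X has_vector_derivative x) (at t within {0..1})"
      "(?Y has_vector_derivative (- p) *\<^sub>R x) (at t within {0..1})"
      by (auto intro!: derivative_eq_intros)
    from smooth2_along_curve[OF smooth_P _ _ this] slit[OF t]
    have "((\<lambda>t. P (?X t) (?Y t)) has_real_derivative
        grad_x P (?X t) (?Y t) x + grad_y P (?X t) (?Y t) ((- p) *\<^sub>R x)) (at t within {0..1})"
      by blast
    moreover have "grad_x P (?X t) (?Y t) x + grad_y P (?X t) (?Y t) ((- p) *\<^sub>R x)
        = grad_y P (?X t) (?Y t) x * (P (?X t) (?Y t) - p)"
      using grad_transport slit[OF t]
      by (simp add: sum_distrib_left sum_distrib_right sum_negf algebra_simps flip: sum_subtractf)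
    ultimately show "((\<lambda>t. P (?X t) (?Y t) - p) has_real_derivative
        grad_y P (?X t) (?Y t) x * (P (?X t) (?Y t) - p)) (at t within {0..1})"
      by (auto intro!: derivative_eq_intros)
  qed auto
  then show ?thesis by (simp add: p_def)
qed

text \<open>Differentiating the constancy of \<open>P\<close> with respect to the starting point \<open>y\<^sub>0\<close> in direction \<open>x\<close>.\<close>

lemma char_grad_P:
  assumes x: "x \<in> \<Omega>" "\<bar>b\<bar> * norm x < 1" and y0: "y0 \<noteq> 0" and t: "0 \<le> t" "t \<le> 1"
  shows "grad_y P (t *\<^sub>R x) (y0 - (t * (b * norm y0)) *\<^sub>R x) x * (norm y0 - t * (b * (y0 \<bullet> x))) = b * (y0 \<bullet> x)"
proof -
  define k where "k = b * ((y0 \<bullet> x) / norm y0)"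
  let ?Y = "\<lambda>s. (y0 + s *\<^sub>R x) - (t * (b * norm (y0 + s *\<^sub>R x))) *\<^sub>R x"
  have tx: "t *\<^sub>R x \<in> \<Omega>" using star[OF x(1) t] .
  have small: "\<bar>b\<bar> * norm (t *\<^sub>R x) < 1"
  proof -
    have "\<bar>b\<bar> * norm (t *\<^sub>R x) = t * (\<bar>b\<bar> * norm x)" using t by simp
    also have "\<dots> \<le> 1 * (\<bar>b\<bar> * norm x)" using t by (intro mult_right_mono) auto
    finally show ?thesis using x(2) by simp
  qed
  have n: "((\<lambda>s. b * norm (y0 + s *\<^sub>R x)) has_real_derivative k) (at 0)"
    unfolding k_def by (rule DERIV_cmult[OF norm_line_derivative[OF y0]])
  \<comment> \<open>Moving the starting point along x moves the end point by (1 - t k) x, again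
    along x; so the chain rule sees only P_y x.\<close>
  have "(?Y has_vector_derivative x - (t * k) *\<^sub>R x) (at 0)"
    by (rule derivative_eq_intros n[unfolded has_real_derivative_iff_has_vector_derivative]
          n DERIV_cmult refl | simp)+
  from smooth2_along_curve[OF smooth_P _ _ has_vector_derivative_const this, of "t *\<^sub>R x"]
  have 1: "((\<lambda>s. P (t *\<^sub>R x) (?Y s)) has_real_derivative
      grad_y P (t *\<^sub>R x) (?Y 0) (x - (t * k) *\<^sub>R x)) (at 0)"
    using tx char_nonzero[OF x(2) y0 t] by simp
  \<comment> \<open>By \<open>char_P\<close> at the end point t x, with starting point y0 + s x,
    this function equals b |y0 + s x| for all s near 0.\<close>
  have "((\<lambda>s. P (t *\<^sub>R x) (?Y s)) has_real_derivative k) (at 0)"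
    by (rule has_field_derivative_transform_within_open[OF n open_line_slit[OF y0, of x]])
      (use char_P[OF tx small] in \<open>simp add: mult_ac\<close>)
  with 1 have "grad_y P (t *\<^sub>R x) (?Y 0) (x - (t * k) *\<^sub>R x) = k" by (rule DERIV_unique)
  moreover have "grad_y P (t *\<^sub>R x) (?Y 0) (x - (t * k) *\<^sub>R x) = grad_y P (t *\<^sub>R x) (?Y 0) x * (1 - t * k)"
    unfolding sum_distrib_right by (intro sum.cong refl) (simp add: algebra_simps)
  ultimately have "grad_y P (t *\<^sub>R x) (?Y 0) x * (1 - t * k) = k" by simp
  then have q: "grad_y P (t *\<^sub>R x) (?Y 0) x * (1 - t * k) * norm y0 = k * norm y0" by (simp only:)
  have k: "b * (y0 \<bullet> x) = k * norm y0" using y0 by (simp add: k_def)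
  have dist: "A * (n - t * (k * n)) = A * (1 - t * k) * n" for A n :: real by (simp add: algebra_simps)
  show ?thesis unfolding k dist using q by simp
qed

text \<open>Along the characteristic P = p, and Hamel's condition leaves F' = (P_y x) F. By
  \<open>char_grad_P\<close> the other factor decays at exactly the opposite rate, so the product
  keeps its value a |y0|^2 from t = 0.\<close>

lemma char_F:
  assumes x: "x \<in> \<Omega>" "\<bar>b\<bar> * norm x < 1" and y0: "y0 \<noteq> 0"
  shows "F x (y0 - (b * norm y0) *\<^sub>R x) * (norm y0 - b * (y0 \<bullet> x)) = a * (norm y0)\<^sup>2"
proof -
  define p where "p = b * norm y0"
  let ?X = "\<lambda>t::real. t *\<^sub>R x" and ?Y = "\<lambda>t::real. y0 - (t * p) *\<^sub>R x"
  have slit: "?X t \<in> \<Omega>" "?Y t \<noteq> 0" if "t \<in> {0..1}" for t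
    using star[OF x(1)] char_nonzero[OF x(2) y0] that by (auto simp: p_def)
  have Pp: "P (?X t) (?Y t) = p" if t: "t \<in> {0..1}" for t
  proof -
    have "\<bar>b\<bar> * norm (t *\<^sub>R x) = t * (\<bar>b\<bar> * norm x)" using t by simp
    also have "\<dots> \<le> 1 * (\<bar>b\<bar> * norm x)" using t by (intro mult_right_mono) auto
    finally have "\<bar>b\<bar> * norm (t *\<^sub>R x) < 1" using x(2) by simp
    from char_P[OF slit(1)[OF t] this y0] show ?thesis by (simp add: p_def mult_ac)
  qed
  have "((\<lambda>t. F (?X t) (?Y t) * (norm y0 - t * (b * (y0 \<bullet> x)))) has_real_derivative 0) (at t within {0..1})"
    if t: "t \<in> {0..1}" for t
  proof -
    have "(?X has_vector_derivative x) (at t within {0..1})"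
      "(?Y has_vector_derivative (- p) *\<^sub>R x) (at t within {0..1})"
      by (auto intro!: derivative_eq_intros)
    from smooth2_along_curve[OF smooth_F slit[OF t] this]
    have "((\<lambda>t. F (?X t) (?Y t)) has_real_derivative
        grad_x F (?X t) (?Y t) x + grad_y F (?X t) (?Y t) ((- p) *\<^sub>R x)) (at t within {0..1})" .
    moreover have "grad_x F (?X t) (?Y t) x + grad_y F (?X t) (?Y t) ((- p) *\<^sub>R x)
        = grad_y P (?X t) (?Y t) x * F (?X t) (?Y t)"
      unfolding grad_hamel[OF slit[OF t]] Pp[OF t] by (simp add: sum_distrib_left sum_negf mult_ac)
    ultimately have d: "((\<lambda>t. F (?X t) (?Y t)) has_real_derivative
        grad_y P (?X t) (?Y t) x * F (?X t) (?Y t)) (at t within {0..1})" by simp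
    have q: "grad_y P (?X t) (?Y t) x * (norm y0 - t * (b * (y0 \<bullet> x))) = b * (y0 \<bullet> x)"
      using char_grad_P[OF x y0, of t] t by (simp add: p_def)
    have ac: "A * B * C = B * (A * C)" for A B C :: real by simp
    show ?thesis
    proof (rule derivative_eq_intros d refl)+
      have "grad_y P (?X t) (?Y t) x * F (?X t) (?Y t) * (norm y0 - t * (b * (y0 \<bullet> x)))
          = F (?X t) (?Y t) * (b * (y0 \<bullet> x))"
        by (simp only: ac q)
      then show "grad_y P (?X t) (?Y t) x * F (?X t) (?Y t) * (norm y0 - t * (b * (y0 \<bullet> x)))
          + (0 - (1 * (b * (y0 \<bullet> x)) + 0 * t)) * F (?X t) (?Y t) = 0" by simp
    qed
  qed
  from has_field_derivative_zero_constant[OF convex_real_interval(5) this]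
  obtain k where k: "\<forall>t\<in>{0..1}. F (?X t) (?Y t) * (norm y0 - t * (b * (y0 \<bullet> x))) = k" ..
  have "F (?X 1) (?Y 1) * (norm y0 - 1 * (b * (y0 \<bullet> x))) = k"
    "F (?X 0) (?Y 0) * (norm y0 - 0 * (b * (y0 \<bullet> x))) = k"
    using k[rule_format, of 1] k[rule_format, of 0] by simp_all
  then show ?thesis using F_0[OF y0] by (simp add: p_def power2_eq_square)
qed

text \<open>At \<open>|x| = 1 / |b|\<close> the characteristic through \<open>(0, \<plusminus>x)\<close> would make \<open>F\<close> blow up.\<close>

lemma char_radius:
  assumes a: "a > 0" and x: "x \<in> \<Omega>"
  shows "\<bar>b\<bar> * norm x < 1"
proof (rule ccontr)
  assume "\<not> \<bar>b\<bar> * norm x < 1"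
  then have ge: "\<bar>b\<bar> * norm x \<ge> 1" by simp
  then have b: "b \<noteq> 0" and xn: "x \<noteq> 0" by auto
  \<comment> \<open>The point of the segment from 0 to x on the critical sphere of radius
    1/|b|.\<close>
  define w where "w = (1 / (\<bar>b\<bar> * norm x)) *\<^sub>R x"
  have w: "w \<in> \<Omega>" unfolding w_def using ge by (intro star[OF x]) auto
  have nw: "norm w = 1 / \<bar>b\<bar>" using b xn by (simp add: w_def)
  \<comment> \<open>The sign is chosen so that the characteristic starting at e contracts: over t w
    it sits at (1 - t) e.\<close>
  define e where "e = sgn b *\<^sub>R w"
  have ne: "norm e = 1 / \<bar>b\<bar>" using b nw by (simp add: e_def abs_sgn_eq)
  have e0: "e \<noteq> 0" using ne b by auto
  \<comment> \<open>One factor 1 - t comes from homogeneity of F, the other from the conserved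
    product. So \<open>?f\<close> is a positive constant for t < 1, yet by continuity it must equal
    its value 0 at t = 1.\<close>
  let ?f = "\<lambda>t. F (t *\<^sub>R w) e * ((1 - t)\<^sup>2 * norm e)"
  have cont: "continuous_on {0..1} ?f"
    by (intro continuous_intros smooth2_continuous_on[OF smooth_F]) (use star[OF w] e0 in auto)
  have const: "?f t = a * (norm e)\<^sup>2" if t: "t \<in> {0..<1}" for t
  proof -
    have tw: "t *\<^sub>R w \<in> \<Omega>" using star[OF w] t by auto
    have bt: "\<bar>b\<bar> * norm (t *\<^sub>R w) = t" using t b by (simp add: nw)
    have lt: "\<bar>b\<bar> * norm (t *\<^sub>R w) < 1" unfolding bt using t by simp
    have bn: "b * norm e = sgn b" using b by (simp add: ne sgn_real_def)
    have "e - (b * norm e) *\<^sub>R (t *\<^sub>R w) = (1 - t) *\<^sub>R e"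
      unfolding bn by (simp add: e_def algebra_simps)
    moreover have "b * (e \<bullet> (t *\<^sub>R w)) = t * norm e"
    proof -
      have "b * (e \<bullet> (t *\<^sub>R w)) = t * (\<bar>b\<bar> * (norm w)\<^sup>2)"
        by (simp add: e_def power2_norm_eq_inner abs_sgn mult_ac)
      also have "\<dots> = t * norm e" using b by (cases "b > 0") (auto simp: nw ne power2_eq_square)
      finally show ?thesis .
    qed
    ultimately have "F (t *\<^sub>R w) ((1 - t) *\<^sub>R e) * (norm e - t * norm e) = a * (norm e)\<^sup>2"
      using char_F[OF tw lt e0] by (simp only:)
    moreover have "F (t *\<^sub>R w) ((1 - t) *\<^sub>R e) = (1 - t) * F (t *\<^sub>R w) e"
      using hom_F tw e0 t by (simp add: hom2_def)
    ultimately have "(1 - t) * F (t *\<^sub>R w) e * (norm e - t * norm e) = a * (norm e)\<^sup>2" by (simp only:)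
    moreover have "F (t *\<^sub>R w) e * ((1 - t)\<^sup>2 * norm e) = (1 - t) * F (t *\<^sub>R w) e * (norm e - t * norm e)"
      by (simp add: power2_eq_square algebra_simps)
    ultimately show ?thesis by (simp only:)
  qed
  have "?f 1 = a * (norm e)\<^sup>2"
    by (rule continuous_constant_on_closure[where S = "{0..<1}"]) (use cont const in auto)
  then show False using a e0 by simp
qed

text \<open>Every (x, y) with y nonzero is reached: y0 = y + b N x has norm N, which inverts y = y0
  - b |y0| x. At the end point the factor N - b <y0, x> is z.\<close>

lemma char_formula:
  assumes a: "a > 0" and x: "x \<in> \<Omega>"
  shows "F x y = a * berwald b x y"
proof (cases "y = 0")
  case True
  then show ?thesis using F_zero[OF x] by (simp add: berwald_def)
next
  case False
  have bx: "\<bar>b\<bar> * norm x < 1" by (rule char_radius[OF a x])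
  then have "(\<bar>b\<bar> * norm x)\<^sup>2 < 1" by (simp add: power_less_one_iff)
  then have s: "b\<^sup>2 * (x \<bullet> x) < 1" by (simp add: power_mult_distrib power2_norm_eq_inner)
  let ?N = "berwald_root b x y" and ?z = "z_fun b x y"
  have N: "?N > 0" and z: "?z > 0" using berwald_root_pos[OF s False] z_fun_pos[OF s False] by auto
  define y0 where "y0 = y + (b * ?N) *\<^sub>R x"
  have n: "norm y0 = ?N" unfolding y0_def by (rule berwald_root_norm[OF s False])
  then have "y0 \<noteq> 0" using N by auto
  from char_F[OF x bx this] have "F x y * (?N - b * (y0 \<bullet> x)) = a * ?N\<^sup>2"
    unfolding n by (simp add: y0_def)
  moreover have "?N - b * (y0 \<bullet> x) = ?z"
    unfolding berwald_root_z[OF s False] y0_def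
    by (simp add: inner_simps inner_commute power2_eq_square algebra_simps)
  ultimately have "F x y = a * ?N\<^sup>2 / ?z" using z by (simp add: eq_divide_eq)
  then show ?thesis using berwald_eq[OF s False] by simp
qed

end

text \<open>Since |t y| is not differentiable at t = 0, the profile \<zeta> is not differentiated.
  Instead F(t y, y) is compared with the same expression along a reference unit vector e, on which
  it depends through |y| alone.\<close>

lemma radial_at_origin:
  assumes prof: "has_radial_profile \<Omega> F \<zeta>" and 0: "0 \<in> \<Omega>"
  obtains a b where "a > 0" "\<And>y. y \<noteq> 0 \<Longrightarrow> F 0 y = a * norm y" "\<And>y. y \<noteq> 0 \<Longrightarrow> P 0 y = b * norm y"
proof -
  have Fz: "F x y = norm y * \<zeta> (norm x) ((x \<bullet> y) / norm y)" if "x \<in> \<Omega>" "y \<noteq> 0" for x y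
    using prof that unfolding has_radial_profile_def by blast
  define e :: "real ^ 'n" where "e = axis undefined 1"
  have e: "norm e = 1" "e \<noteq> 0" "e \<bullet> e = 1" by (auto simp: e_def axis_eq_0_iff inner_axis_axis)
  define a where "a = \<zeta> 0 0"
  define b where "b = grad_x F 0 e e / (2 * a)"
  have F0: "F 0 y = a * norm y" if "y \<noteq> 0" for y
    using Fz[OF 0 that] by (simp add: a_def)
  have a: "a > 0" using F_pos[OF 0 e(2)] F0[OF e(2)] e(1) by simp
  have line: "((\<lambda>t. F (t *\<^sub>R v) w) has_real_derivative grad_x F 0 w v) (at 0)" if "w \<noteq> 0" for v w
  proof -
    have "((\<lambda>t. t *\<^sub>R v) has_vector_derivative v) (at 0)" by (auto intro!: derivative_eq_intros)
    from smooth2_along_curve[OF smooth_F _ _ this, of "\<lambda>_. w" 0] 0 that show ?thesis by simp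
  qed
  have P0: "P 0 y = b * norm y" if y: "y \<noteq> 0" for y
  proof -
    have "((\<lambda>t. F (t *\<^sub>R (norm y *\<^sub>R e)) e) has_real_derivative grad_x F 0 e (norm y *\<^sub>R e)) (at 0)"
      by (rule line[OF e(2)])
    then have "((\<lambda>t. norm y * F (t *\<^sub>R (norm y *\<^sub>R e)) e) has_real_derivative norm y * grad_x F 0 e (norm y *\<^sub>R e)) (at 0)"
      by (rule DERIV_cmult)
    then have "((\<lambda>t. F (t *\<^sub>R y) y) has_real_derivative norm y * grad_x F 0 e (norm y *\<^sub>R e)) (at 0)"
    proof (rule has_field_derivative_transform_within_open)
      let ?T = "(\<lambda>t::real. 0 + t *\<^sub>R y) -` \<Omega> \<inter> (\<lambda>t::real. 0 + t *\<^sub>R (norm y *\<^sub>R e)) -` \<Omega>"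
      show "open ?T" "0 \<in> ?T" using open_line[OF 0] by blast+
      fix t assume t: "t \<in> ?T"
      then show "norm y * F (t *\<^sub>R (norm y *\<^sub>R e)) e = F (t *\<^sub>R y) y"
        using y e Fz[of "t *\<^sub>R y" y] Fz[of "t *\<^sub>R (norm y *\<^sub>R e)" e]
        by (simp add: power2_eq_square abs_mult flip: power2_norm_eq_inner)
    qed
    with line[OF y] have "grad_x F 0 y y = norm y * grad_x F 0 e (norm y *\<^sub>R e)" by (rule DERIV_unique)
    also have "\<dots> = (norm y)\<^sup>2 * grad_x F 0 e e"
      by (simp add: power2_eq_square sum_distrib_left mult_ac)
    finally show ?thesis using y a by (simp add: proj_factor_def F0 b_def power2_eq_square)
  qed
  show thesis by (rule that[OF a F0 P0])
qed

lemma flat_iff_berwald: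
  assumes n: "CARD('n) \<ge> 2" and convex: "convex \<Omega>" and 0: "0 \<in> \<Omega>"
    and prof: "has_radial_profile \<Omega> F \<zeta>"
  shows "projectively_flat \<Omega> F \<and> zero_flag_curvature \<Omega> F \<longleftrightarrow>
    (\<exists>a>0. \<exists>c. \<forall>x\<in>\<Omega>. \<forall>y. F x y = a * berwald c x y)"
proof
  have star: "t *\<^sub>R x \<in> \<Omega>" if "x \<in> \<Omega>" "0 \<le> t" "t \<le> 1" for x t
    using convexD[OF convex that(1) 0, of t "1 - t"] that by simp
  {
    assume flat: "projectively_flat \<Omega> F \<and> zero_flag_curvature \<Omega> F"
    obtain a b where ab: "a > 0" "\<And>y. y \<noteq> 0 \<Longrightarrow> F 0 y = a * norm y" "\<And>y. y \<noteq> 0 \<Longrightarrow> P 0 y = b * norm y"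
      using radial_at_origin[OF prof 0] by blast
    have par: "G i x y = P x y * y $ i" if "x \<in> \<Omega>" "y \<noteq> 0" for x y i
      using projectively_flat_imp_parallel flat that by blast
    have hamel: "dx k F x y = dy k P x y * F x y + P x y * dy k F x y" if "x \<in> \<Omega>" "y \<noteq> 0" for x y k
      using parallel_iff[OF that] par[OF that] by blast
    have tr: "dx k P x y = P x y * dy k P x y" if "x \<in> \<Omega>" "y \<noteq> 0" for x y k
      using zero_flag_curvature_imp_transport[OF par n conjunct2[OF flat] that] by blast
    have "F x y = a * berwald b x y" if "x \<in> \<Omega>" for x y
      by (rule char_formula[OF star hamel tr ab(2,3,1) that])
    with ab(1) show "\<exists>a>0. \<exists>c. \<forall>x\<in>\<Omega>. \<forall>y. F x y = a * berwald c x y" by blast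
  next
    assume "\<exists>a>0. \<exists>c. \<forall>x\<in>\<Omega>. \<forall>y. F x y = a * berwald c x y"
    then obtain a c where F: "\<And>x y. x \<in> \<Omega> \<Longrightarrow> F x y = a * berwald c x y" by blast
    \<comment> \<open>If this failed, the domain would contain a point w with |w| = 1/|c|. A nonzero
      y orthogonal to w has z = 0 there, so the quotient is 0 and F(w, y) = 0, against
      positivity.\<close>
    have small: "c\<^sup>2 * (x \<bullet> x) < 1" if x: "x \<in> \<Omega>" for x
    proof (rule ccontr)
      assume "\<not> c\<^sup>2 * (x \<bullet> x) < 1"
      then have ge: "(\<bar>c\<bar> * norm x)\<^sup>2 \<ge> 1" by (simp add: power_mult_distrib power2_norm_eq_inner)
      then have ge1: "\<bar>c\<bar> * norm x \<ge> 1"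
        by (metis abs_ge_zero mult_nonneg_nonneg norm_ge_zero not_le power_less_one_iff zero_less_numeral pos2)
      define w where "w = (1 / (\<bar>c\<bar> * norm x)) *\<^sub>R x"
      have w: "w \<in> \<Omega>" unfolding w_def using ge1 by (intro star[OF x]) auto
      have "\<bar>c\<bar> * norm w = 1" using ge1 by (auto simp: w_def)
      then have "(\<bar>c\<bar> * norm w)\<^sup>2 = 1" by simp
      then have cw: "c\<^sup>2 * (norm w)\<^sup>2 = 1" by (simp add: power_mult_distrib)
      obtain y where y: "y \<noteq> 0" "orthogonal w y"
        using orthogonal_to_vector_exists[of w] n by auto
      then have "z_fun c w y = 0" using cw by (simp add: z_fun_def orthogonal_def)
      then have "F w y = 0" using F[OF w] by (simp add: berwald_def)
      then show False using F_pos[OF w y(1)] by simp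
    qed
    show "projectively_flat \<Omega> F \<and> zero_flag_curvature \<Omega> F"
      using berwald_flat[OF F small] by blast
  }
qed

end

lemma berwald_0: "berwald 0 x y = norm y"
  by (cases "y = 0") (auto simp: berwald_def z_fun_def power4_eq_xxxx power2_eq_square)

lemma berwald_minus: "berwald (- c) x y = (norm y) ^ 4 / (z_fun c x y * (c * (x \<bullet> y) + z_fun c x y)\<^sup>2)"
  by (simp add: berwald_def z_fun_def power2_eq_square algebra_simps)

text \<open>The factor a reflects that multiplying F by a positive constant preserves both
  properties; it is the ratio of F(0, y) to |y|.\<close>

theorem theorem7p2:
  fixes \<Omega> :: "(real ^ 'n) set"
    and F :: "real ^ 'n \<Rightarrow> real ^ 'n \<Rightarrow> real"
    and \<zeta> :: "real \<Rightarrow> real \<Rightarrow> real"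
  assumes "CARD('n) \<ge> 2"
    and "convex_domain \<Omega>"
    and "finsler_metric \<Omega> F"
    and "spherically_symmetric \<Omega> F"
    and "has_radial_profile \<Omega> F \<zeta>"
  shows "projectively_flat \<Omega> F \<and> zero_flag_curvature \<Omega> F \<longleftrightarrow>
    (\<exists>a>0. \<forall>x\<in>\<Omega>. \<forall>y. F x y = a * norm y) \<or>
    (\<exists>a>0. \<exists>c. c \<noteq> 0 \<and>
       ((\<forall>x\<in>\<Omega>. \<forall>y. F x y = a * ((norm y) ^ 4 / (z_fun c x y * (c * (x \<bullet> y) + z_fun c x y)\<^sup>2))) \<or>
        (\<forall>x\<in>\<Omega>. \<forall>y. F x y = a * ((norm y) ^ 4 / (z_fun c x y * (c * (x \<bullet> y) - z_fun c x y)\<^sup>2)))))"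
proof -
  have o: "open \<Omega>" and c: "convex \<Omega>" and "\<Omega> \<noteq> {}"
    using assms(2) by (auto simp: convex_domain_def)
  interpret finsler_domain \<Omega> F using o assms(3) by unfold_locales
  obtain x where x: "x \<in> \<Omega>" using \<open>\<Omega> \<noteq> {}\<close> by blast
  \<comment> \<open>Minus the identity is orthogonal, so the domain is symmetric about the origin
    and convexity places the midpoint 0 of x and -x in it.\<close>
  have ot: "orthogonal_transformation (uminus :: real ^ 'n \<Rightarrow> _)"
    by (simp add: orthogonal_transformation_def linear_iff)
  then have "matrix uminus *v x \<in> \<Omega>"
    using assms(4) x unfolding spherically_symmetric_def orthogonal_transformation_matrix by blast
  then have "- x \<in> \<Omega>" using ot by (simp add: orthogonal_transformation_matrix matrix_works)
  then have 0: "0 \<in> \<Omega>" using convexD[OF c x, of "- x" "1/2" "1/2"] by simp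
  have "projectively_flat \<Omega> F \<and> zero_flag_curvature \<Omega> F \<longleftrightarrow>
    (\<exists>a>0. \<exists>c. \<forall>x\<in>\<Omega>. \<forall>y. F x y = a * berwald c x y)"
    by (rule flat_iff_berwald[OF assms(1) c 0 assms(5)])
  \<comment> \<open>Splits off c = 0. For c nonzero the two signs name the same family, since c may
    be replaced by -c.\<close>
  also have "\<dots> \<longleftrightarrow> (\<exists>a>0. \<forall>x\<in>\<Omega>. \<forall>y. F x y = a * berwald 0 x y) \<or>
    (\<exists>a>0. \<exists>c. c \<noteq> 0 \<and> ((\<forall>x\<in>\<Omega>. \<forall>y. F x y = a * berwald (- c) x y) \<or>
      (\<forall>x\<in>\<Omega>. \<forall>y. F x y = a * berwald c x y)))"
    by (metis (no_types, lifting))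
  finally show ?thesis unfolding berwald_0 berwald_minus unfolding berwald_def .
qed

end
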